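(* Let $d\geq 1$, $k\in\{0,\ldots,d-1\}$, let $I$ be a denumerable set and let $(P_{i},r_{i})_{i\in I}\in\mathcal{S}_{d}^k(I)$. Let $h\in\mathfrak{D}_{d-k}$ and let $V$ be a nonempty open subset of $\mathbb{R}^d$. Assume that: (A) there exists an affine subspace $T$ of $\mathbb{R}^d$ with dimension $d-k$ such that $T\cap P_{i}\neq\emptyset$ for all $i\in I$ and \[ C=\sup_{i\in I}\bigl|\{x\in T \:|\: \mathrm{d}(x,P_{i})<1\}\bigr|<\infty; \] (B) there exists a gauge function $\underline{h}\in\mathfrak{D}_{d-k}$ with $h\prec\underline{h}$ such that for Lebesgue-almost every $x\in V$, there are infinitely many indices $i\in I$ enjoying \[ \mathrm{d}(x,P_{i})<\underline{h}(r_{i})^{\frac{1}{d-k}}. \] Then the set \[ \mathcal{F}_{(P_{i},r_{i})_{i\in I}}=\left\{ x\in\mathbb{R}^d \:\bigl|\: \mathrm{d}(x,P_{i})<r_{i} \text{ for infinitely many } i\in I \right\} \] belongs to the class $\mathrm{G}^{\mathrm{Id}^k h}(V)$, where $\mathrm{Id}^k h$ denotes the function $r\mapsto r^k h(r)$.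
   Context: $\mathbb{R}^d$ is endowed with a norm and $\mathrm{d}(x,P)$ is the associated distance from a point to a set; $|A|$ denotes the diameter of a set $A$. For an integer $e\geq 1$, $\mathfrak{D}_{e}$ is the set of all functions $g$ which vanish at zero, are continuous and nondecreasing on $[0,\varepsilon]$ and are such that $r\mapsto g(r)/r^e$ is positive and nonincreasing on $(0,\varepsilon]$, for some $\varepsilon>0$. For $g,h\in\mathfrak{D}_{e}$, one writes $g\prec h$ if $g/h$ monotonically tends to infinity at zero. For $k\in\{0,\ldots,d-1\}$ and a denumerable set $I$, $\mathcal{S}_{d}^k(I)$ is the set of all families $(P_{i},r_{i})_{i\in I}$ of affine subspaces $P_{i}$ of $\mathbb{R}^d$ of dimension $k$ and positive reals $r_{i}$ such that $\sup_{i}r_{i}<\infty$ and, for every $m\in\mathbb{N}$, only finitely many $i\in I$ satisfy both $P_{i}\cap B_{m}\neq\emptyset$ and $r_{i}>1/m$, where $B_{m}$ is the open ball of center $0$ and radius $m$. Net measures: fix an integer $c\geq 2$; a $c$-adic cube of $\mathbb{R}^d$ is a set $c^{-j}(\kappa+[0,1)^d)$ with $j\in\mathbb{Z}$, $\kappa\in\mathbb{Z}^d$. For $g\in\mathfrak{D}_{d}$, let $\varepsilon_{g}$ be the supremum of the $\varepsilon\in(0,1]$ such that $g$ is nondecreasing on $[0,\varepsilon]$ and $r\mapsto g(r)/r^d$ is nonincreasing on $(0,\varepsilon]$. For $F\subseteq\mathbb{R}^d$, $\mathcal{M}^g_{\infty}(F)=\inf\sum_{p\geq1}g(\mathrm{diam}\,\lambda_{p})$,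 the infimum being over all sequences $(\lambda_{p})$ covering $F$ where each $\lambda_{p}$ is either the empty set or a $c$-adic cube of diameter less than $\varepsilon_{g}$ (with $g(\mathrm{diam}\,\emptyset)=0$). Class of sets with large intersection: for $g\in\mathfrak{D}_{d}$ and $V\subseteq\mathbb{R}^d$ nonempty open, $\mathrm{G}^g(V)$ is the collection of all $G_{\delta}$-subsets $F$ of $\mathbb{R}^d$ such that $\mathcal{M}^{\overline{g}}_{\infty}(F\cap U)=\mathcal{M}^{\overline{g}}_{\infty}(U)$ for every $\overline{g}\in\mathfrak{D}_{d}$ with $\overline{g}\prec g$ and every open set $U\subseteq V$ (this class does not depend on the choice of $c$ or of the norm).
   Formalization: In (B), the gauge function h̲ is additionally assumed to be bounded on the set of radii {r_i}; without this the claim fails, since gauge functions are unconstrained away from zero and the radii r_i need not be small. *)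

theory Defs
  imports "HOL-Analysis.Analysis"
begin

text \<open>The ambient space is \<open>real ^ 'n\<close>, so \<open>d = CARD('n)\<close>. It carries an arbitrary
  norm \<open>N\<close>, unrelated to the Euclidean norm of the type; distances, balls and diameters are
  taken with respect to \<open>N\<close>.\<close>

definition is_norm :: "('a::real_vector \<Rightarrow> real) \<Rightarrow> bool" where
  "is_norm N \<longleftrightarrow>
     (\<forall>x. 0 \<le> N x) \<and> (\<forall>x. N x = 0 \<longleftrightarrow> x = 0) \<and>
     (\<forall>a x. N (a *\<^sub>R x) = \<bar>a\<bar> * N x) \<and> (\<forall>x y. N (x + y) \<le> N x + N y)"

definition distN :: "('a::real_vector \<Rightarrow> real) \<Rightarrow> 'a \<Rightarrow> 'a set \<Rightarrow> real" where
  "distN N x P = (INF p\<in>P. N (x - p))"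

text \<open>Diameters may be infinite; the empty set has diameter \<open>0\<close>.\<close>

definition diamN :: "('a::real_vector \<Rightarrow> real) \<Rightarrow> 'a set \<Rightarrow> ennreal" where
  "diamN N A = (SUP x\<in>A. SUP y\<in>A. ennreal (N (x - y)))"

text \<open>Gauge functions are total functions on the reals, about which nothing is assumed
  outside some interval \<open>{0..\<epsilon>}\<close>. A hypothesis that evaluates a gauge \<open>g\<close> at radii \<open>r i\<close>
  which need not be small is therefore to be accompanied by a bound on the values \<open>g (r i)\<close>.\<close>

definition gauges :: "nat \<Rightarrow> (real \<Rightarrow> real) set" where
  "gauges e = {g. g 0 = 0 \<and>
     (\<exists>\<epsilon>>0. continuous_on {0..\<epsilon>} g \<and> mono_on {0..\<epsilon>} g \<and>
        (\<forall>r\<in>{0<..\<epsilon>}. 0 < g r / r ^ e) \<and>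
        antimono_on {0<..\<epsilon>} (\<lambda>r. g r / r ^ e))}"

definition gauge_prec :: "(real \<Rightarrow> real) \<Rightarrow> (real \<Rightarrow> real) \<Rightarrow> bool" where
  "gauge_prec g h \<longleftrightarrow>
     (\<exists>\<delta>>0. antimono_on {0<..\<delta>} (\<lambda>r. g r / h r)) \<and>
     filterlim (\<lambda>r. g r / h r) at_top (at_right 0)"

definition approx_systems ::
  "(real ^ 'n \<Rightarrow> real) \<Rightarrow> nat \<Rightarrow> 'i set \<Rightarrow> (('i \<Rightarrow> (real ^ 'n) set) \<times> ('i \<Rightarrow> real)) set" where
  "approx_systems N k I = {(P, r).
     (\<forall>i\<in>I. affine (P i) \<and> aff_dim (P i) = int k \<and> 0 < r i) \<and>
     bdd_above (r ` I) \<and>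
     (\<forall>m::nat. finite {i\<in>I. P i \<inter> {x. N x < real m} \<noteq> {} \<and> 1 / real m < r i})}"

definition limsup_set ::
  "('a::real_vector \<Rightarrow> real) \<Rightarrow> 'i set \<Rightarrow> ('i \<Rightarrow> 'a set) \<Rightarrow> ('i \<Rightarrow> real) \<Rightarrow> 'a set" where
  "limsup_set N I P r = {x. infinite {i\<in>I. distN N x (P i) < r i}}"

definition adic_cubes :: "nat \<Rightarrow> (real ^ 'n) set set" where
  "adic_cubes c =
     {(\<lambda>y. (real c powi (- j)) *\<^sub>R ((\<chi> l. real_of_int (\<kappa> $ l)) + y)) `
        {y. \<forall>l. 0 \<le> y $ l \<and> y $ l < 1} | (j::int) (\<kappa>::int ^ 'n). True}"

definition gauge_eps :: "nat \<Rightarrow> (real \<Rightarrow> real) \<Rightarrow> real" where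
  "gauge_eps e g = Sup {\<epsilon>\<in>{0<..1}. mono_on {0..\<epsilon>} g \<and> antimono_on {0<..\<epsilon>} (\<lambda>r. g r / r ^ e)}"

definition net_covers ::
  "(real ^ 'n \<Rightarrow> real) \<Rightarrow> nat \<Rightarrow> (real \<Rightarrow> real) \<Rightarrow> (real ^ 'n) set \<Rightarrow> (nat \<Rightarrow> (real ^ 'n) set) set" where
  "net_covers N c g F = {Q. F \<subseteq> (\<Union>p. Q p) \<and>
     (\<forall>p. Q p = {} \<or>
        (Q p \<in> adic_cubes c \<and> diamN N (Q p) < ennreal (gauge_eps CARD('n) g)))}"

text \<open>The empty set contributes \<open>g 0 = 0\<close>, and cubes have finite diameter, so \<open>enn2real\<close>
  never meets infinity here.\<close>

definition net_content ::
  "(real ^ 'n \<Rightarrow> real) \<Rightarrow> nat \<Rightarrow> (real \<Rightarrow> real) \<Rightarrow> (real ^ 'n) set \<Rightarrow> ennreal" where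
  "net_content N c g F =
     (INF Q\<in>net_covers N c g F. \<Sum>p. ennreal (g (enn2real (diamN N (Q p)))))"

definition large_intersection_class ::
  "(real ^ 'n \<Rightarrow> real) \<Rightarrow> nat \<Rightarrow> (real \<Rightarrow> real) \<Rightarrow> (real ^ 'n) set \<Rightarrow> (real ^ 'n) set set" where
  "large_intersection_class N c g V = {F. gdelta_in euclidean F \<and>
     (\<forall>g'\<in>gauges CARD('n). gauge_prec g' g \<longrightarrow>
        (\<forall>U. open U \<and> U \<subseteq> V \<longrightarrow> net_content N c g' (F \<inter> U) = net_content N c g' U))}"

end

theory Submission
  imports Defs
begin

text \<open>
  Fix a gauge \<open>g\<close> below \<open>Id^k h\<close>, so that \<open>g s / (s^k hl s)\<close> tends to infinity at zero, and let \<open>W n\<close> be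
  the union of the tubes around \<open>P i\<close> of radius \<open>r i\<close> over all but finitely many \<open>i\<close>. In a small cube
  \<open>Q\<close>, Vitali's theorem provides disjoint balls of radius comparable to \<open>hl (r i) powr (1 / (d - k))\<close>, centred on the
  \<open>P i\<close>, that fill \<open>Q\<close> up to a null set. Concentrating the volume of each ball uniformly on the part of a
  tube that it contains yields a measure which gives a cube of diameter \<open>s\<close> at most a constant times
  \<open>s^k hl s\<close>, that is, an arbitrarily small multiple of \<open>g s\<close> once \<open>Q\<close> is small. Hence covering \<open>W n\<close> inside
  small cubes costs an arbitrarily large multiple of the volume, and by additivity of the volume
  covering \<open>W n\<close> inside any cube costs as much as the cube itself: no multiplicative constant is lost.

  The intersection of the \<open>W n\<close> is handled by a Baire-type argument: if a family of cubes were too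
  cheap to cover it inside a cube \<open>Q\<close>, one could find nested cubes, the closure of each
  lying in the next \<open>W n\<close> and in the interior of its predecessor, in each of which the family is still too
  cheap; their common point is not covered.
\<close>

section \<open>Adic cubes\<close>

text \<open>Why the concentration estimate holds: put d = CARD('n), e = d - k, write f for
  \<open>hl\<close>, and spread the volume of a ball of radius R, with R^e comparable to f(r), over
  a plate of length about R in k directions and thickness about r in the others. A cube of size s
  between r and R receives about R^d s^k r^e / (R^k r^e), which is comparable to f(r) s^k: R
  cancels, and this dictates the exponent 1/e. Monotonicity gives f(r) \<le> f(s). If s < r the mass
  is about f(r) s^d / r^e, at most s^k f(s) because f(t) / t^e is nonincreasing. If s > R the cube
  sees whole disjoint balls and receives about s^d, again at most a constant times s^k f(s) because
  f(t) \<ge> \<eta> t^e near zero. So one constant serves all scales and all balls selected by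
  Vitali's theorem.

  Constants become harmless because the multiple of the volume gained on small cubes only has to
  reach the price per unit volume of a cube fixed beforehand. Volume is additive where the content
  is merely subadditive, which is why the comparison is routed through it.\<close>

definition adic_cube :: "nat \<Rightarrow> int \<Rightarrow> real ^ 'n \<Rightarrow> (real ^ 'n) set" where
  "adic_cube c j x = {y. \<forall>l. \<lfloor>real c powi j * y $ l\<rfloor> = \<lfloor>real c powi j * x $ l\<rfloor>}"

lemma adic_cube_self: "x \<in> adic_cube c j x"
  by (simp add: adic_cube_def)

text \<open>A cube is named by its level and a point instead of an index vector, so each of its
  points can serve as its name; comparing two cubes reduces to renaming both by a common
  point.\<close>

lemma adic_cube_eq: "y \<in> adic_cube c j x \<Longrightarrow> adic_cube c j y = adic_cube c j x"
  by (simp add: adic_cube_def)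

text \<open>The scales differ by the integer factor m = c^(j' - j), and the floor of z / m is the
  integer quotient by m of the floor of z: fine floors determine coarse ones.\<close>

lemma adic_cube_mono:
  assumes "0 < c" "j \<le> j'"
  shows "adic_cube c j' x \<subseteq> adic_cube c j x"
proof
  fix y assume y: "y \<in> adic_cube c j' x"
  define m where "m = int (c ^ nat (j' - j))"
  have "real c powi j' = real c powi j * real c powi (j' - j)"
    using assms by (simp flip: power_int_add)
  also have "real c powi (j' - j) = real_of_int m"
    using assms by (simp add: m_def power_int_def)
  finally have eq: "real c powi j * z = (real c powi j' * z) / real_of_int m" for z
    using assms by (simp add: m_def)
  have m: "0 \<le> m" by (simp add: m_def)
  show "y \<in> adic_cube c j x"
    using y unfolding adic_cube_def mem_Collect_eq
    by (metis eq floor_divide_real_eq_div[OF m])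
qed

lemma adic_cube_image:
  fixes \<kappa> :: "int ^ 'n"
  assumes "0 < c"
  shows "(\<lambda>y. (real c powi (- j)) *\<^sub>R ((\<chi> l. real_of_int (\<kappa> $ l)) + y)) `
        {y. \<forall>l. 0 \<le> y $ l \<and> y $ l < 1} = {y. \<forall>l. \<lfloor>real c powi j * y $ l\<rfloor> = \<kappa> $ l}" (is "?f ` _ = _")
proof -
  have nz: "real c powi j \<noteq> 0" using assms by simp
  have "y \<in> ?f ` {y. \<forall>l. 0 \<le> y $ l \<and> y $ l < 1}"
    if "\<forall>l. \<lfloor>real c powi j * y $ l\<rfloor> = \<kappa> $ l" for y :: "real^'n"
  proof (rule image_eqI)
    show "y = ?f (real c powi j *\<^sub>R y - (\<chi> l. real_of_int (\<kappa> $ l)))"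
      using nz by (simp add: power_int_minus)
    show "real c powi j *\<^sub>R y - (\<chi> l. real_of_int (\<kappa> $ l)) \<in> {y. \<forall>l. 0 \<le> y $ l \<and> y $ l < 1}"
    proof (simp, intro allI)
      fix l
      have "\<lfloor>real c powi j * y $ l\<rfloor> = \<kappa> $ l" using that by simp
      then show "real_of_int (\<kappa> $ l) \<le> real c powi j * y $ l \<and> real c powi j * y $ l - real_of_int (\<kappa> $ l) < 1"
        by linarith
    qed
  qed
  moreover have "\<lfloor>real c powi j * ?f y $ l\<rfloor> = \<kappa> $ l" if "\<forall>l. 0 \<le> y $ l \<and> y $ l < 1" for y :: "real^'n" and l
  proof -
    have "0 \<le> y $ l \<and> y $ l < 1" using that by blast
    moreover have "real c powi j * ?f y $ l = real_of_int (\<kappa> $ l) + y $ l"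
      using nz by (simp add: power_int_minus)
    ultimately show ?thesis by linarith
  qed
  ultimately show ?thesis by auto
qed

lemma adic_cubes_eq:
  fixes c :: nat
  assumes "0 < c"
  shows "adic_cubes c = {adic_cube c j x | j x. True}"
proof -
  show ?thesis
  proof (intro equalityI subsetI)
    fix Q :: "(real^'n) set" assume "Q \<in> adic_cubes c"
    then obtain j and \<kappa> :: "int^'n" where Q: "Q = {y. \<forall>l. \<lfloor>real c powi j * y $ l\<rfloor> = \<kappa> $ l}"
      unfolding adic_cubes_def by (auto simp: adic_cube_image[OF assms])
    define x where "x = (\<chi> l. real_of_int (\<kappa> $ l) / real c powi j)"
    have "Q = adic_cube c j x"
      using assms by (simp add: Q adic_cube_def x_def)
    then show "Q \<in> {adic_cube c j x | j x. True}" by blast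
  next
    fix Q :: "(real^'n) set" assume "Q \<in> {adic_cube c j x | j x. True}"
    then obtain j x where Q: "Q = adic_cube c j x" by blast
    define \<kappa> :: "int ^ 'n" where "\<kappa> = (\<chi> l. \<lfloor>real c powi j * x $ l\<rfloor>)"
    have "Q = (\<lambda>y. (real c powi (- j)) *\<^sub>R ((\<chi> l. real_of_int (\<kappa> $ l)) + y)) `
        {y. \<forall>l. 0 \<le> y $ l \<and> y $ l < 1}"
      unfolding adic_cube_image[OF assms] by (simp add: Q adic_cube_def \<kappa>_def)
    then show "Q \<in> adic_cubes c" unfolding adic_cubes_def by blast
  qed
qed

lemma adic_cube_in: "0 < c \<Longrightarrow> adic_cube c j x \<in> adic_cubes c"
  by (auto simp: adic_cubes_eq)

lemma adic_cubes_nonempty: "0 < c \<Longrightarrow> {} \<notin> adic_cubes c"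
  using adic_cube_self by (fastforce simp: adic_cubes_eq)

lemma adic_cubes_nested:
  assumes "0 < c" "C \<in> adic_cubes c" "D \<in> adic_cubes c" "z \<in> C" "z \<in> D"
  shows "C \<subseteq> D \<or> D \<subseteq> C"
proof -
  obtain i x j y where CD: "C = adic_cube c i x" "D = adic_cube c j y"
    using assms by (auto simp: adic_cubes_eq)
  then have "C = adic_cube c i z" "D = adic_cube c j z"
    using assms by (auto simp: adic_cube_eq)
  then show ?thesis
    using adic_cube_mono[OF assms(1)] by (metis linear)
qed

lemma countable_int_vec: "countable (UNIV :: (int ^ 'n) set)"
proof -
  have "countable (PiE (UNIV :: 'n set) (\<lambda>_. UNIV :: int set))"
    by (intro countable_PiE) auto
  moreover have "inj (\<lambda>v :: int ^ 'n. vec_nth v)"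
    by (simp add: inj_on_def vec_nth_inject)
  moreover have "range (\<lambda>v :: int ^ 'n. vec_nth v) \<subseteq> PiE UNIV (\<lambda>_. UNIV)" by auto
  ultimately have "countable (range (\<lambda>v :: int ^ 'n. vec_nth v))"
    using countable_subset by blast
  then show ?thesis using \<open>inj _\<close> by (rule countable_image_inj_on)
qed

lemma countable_adic_cubes: "countable (adic_cubes c :: (real ^ 'n) set set)"
proof -
  let ?f = "\<lambda>(j, \<kappa> :: int ^ 'n). (\<lambda>y :: real ^ 'n. (real c powi (- j)) *\<^sub>R ((\<chi> l. real_of_int (\<kappa> $ l)) + y)) `
        {y. \<forall>l. 0 \<le> y $ l \<and> y $ l < 1}"
  have "adic_cubes c = ?f ` (UNIV \<times> UNIV)"
    by (auto simp: adic_cubes_def image_def)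
  moreover have "countable ((UNIV :: int set) \<times> (UNIV :: (int ^ 'n) set))"
    by (intro countable_SIGMA countable_int_vec) auto
  ultimately show ?thesis by simp
qed

lemma adic_cube_box:
  fixes x :: "real ^ 'n"
  assumes "0 < c"
  obtains u v where "box u v \<subseteq> adic_cube c j x" "adic_cube c j x \<subseteq> cbox u v"
    "\<And>l. v $ l - u $ l = real c powi (- j)"
proof -
  have pos: "real c powi j > 0" using assms by simp
  define u v :: "real ^ 'n" where "u = (\<chi> l. real_of_int \<lfloor>real c powi j * x $ l\<rfloor> / real c powi j)"
    and "v = (\<chi> l. (real_of_int \<lfloor>real c powi j * x $ l\<rfloor> + 1) / real c powi j)"
  show thesis
  proof (rule that)
    show "box u v \<subseteq> adic_cube c j x"
    proof
      fix y assume y: "y \<in> box u v"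
      show "y \<in> adic_cube c j x"
        unfolding adic_cube_def mem_Collect_eq
      proof
        fix l
        have "u $ l < y $ l" "y $ l < v $ l" using y by (auto simp: mem_box_cart)
        then have "real_of_int \<lfloor>real c powi j * x $ l\<rfloor> < real c powi j * y $ l"
          "real c powi j * y $ l < real_of_int \<lfloor>real c powi j * x $ l\<rfloor> + 1"
          using pos by (auto simp: u_def v_def field_simps)
        then show "\<lfloor>real c powi j * y $ l\<rfloor> = \<lfloor>real c powi j * x $ l\<rfloor>" by linarith
      qed
    qed
    show "adic_cube c j x \<subseteq> cbox u v"
    proof
      fix y assume y: "y \<in> adic_cube c j x"
      have "u $ l \<le> y $ l \<and> y $ l \<le> v $ l" for l
      proof -
        have "\<lfloor>real c powi j * y $ l\<rfloor> = \<lfloor>real c powi j * x $ l\<rfloor>" using y by (simp add: adic_cube_def)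
        then have "real_of_int \<lfloor>real c powi j * x $ l\<rfloor> \<le> real c powi j * y $ l"
          "real c powi j * y $ l \<le> real_of_int \<lfloor>real c powi j * x $ l\<rfloor> + 1" by linarith+
        then show ?thesis using pos by (auto simp: u_def v_def field_simps)
      qed
      then show "y \<in> cbox u v" by (simp add: mem_box_cart)
    qed
    show "v $ l - u $ l = real c powi (- j)" for l
      using pos by (simp add: u_def v_def power_int_minus add_divide_distrib inverse_eq_divide)
  qed
qed

lemma adic_cube_norm_diff:
  fixes x :: "real ^ 'n"
  assumes "0 < c" "y \<in> adic_cube c j x" "z \<in> adic_cube c j x"
  shows "norm (y - z) \<le> real CARD('n) * real c powi (- j)"
proof -
  obtain u v where uv: "adic_cube c j x \<subseteq> cbox u v" "\<And>l. v $ l - u $ l = real c powi (- j)"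
    using adic_cube_box[OF assms(1)] by metis
  have "\<bar>(y - z) $ l\<bar> \<le> real c powi (- j)" for l
  proof -
    have "y \<in> cbox u v" "z \<in> cbox u v" using assms uv by auto
    then have "u $ l \<le> y $ l \<and> y $ l \<le> v $ l \<and> u $ l \<le> z $ l \<and> z $ l \<le> v $ l"
      by (simp add: mem_box_cart)
    then show ?thesis using uv(2)[of l] by (simp add: abs_le_iff)
  qed
  then have "(\<Sum>l\<in>UNIV. \<bar>(y - z) $ l\<bar>) \<le> real CARD('n) * real c powi (- j)"
    using sum_bounded_above[of UNIV "\<lambda>l. \<bar>(y - z) $ l\<bar>"] by simp
  then show ?thesis using norm_le_l1_cart order_trans by blast
qed

lemma adic_cube_borel [measurable]: "adic_cube c j x \<in> sets borel"
  unfolding adic_cube_def by measurable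

lemma adic_cubes_borel: "0 < c \<Longrightarrow> C \<in> adic_cubes c \<Longrightarrow> C \<in> sets borel"
  by (auto simp: adic_cubes_eq adic_cube_borel)

text \<open>The cube lies between an open box and its closure, which have equal volume, and the open
  box already lies in the interior.\<close>

lemma
  fixes x :: "real ^ 'n"
  assumes "0 < c"
  shows emeasure_adic_cube: "emeasure lborel (adic_cube c j x) = ennreal ((real c powi (- j)) ^ CARD('n))"
    and emeasure_interior_adic_cube:
      "emeasure lborel (interior (adic_cube c j x)) = ennreal ((real c powi (- j)) ^ CARD('n))"
proof -
  obtain u v where uv: "box u v \<subseteq> adic_cube c j x" "adic_cube c j x \<subseteq> cbox u v"
    "\<And>l. v $ l - u $ l = real c powi (- j)"
    using adic_cube_box[OF assms(1)] by metis
  have le: "u $ l \<le> v $ l" for l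
    using uv(3)[of l] assms by (smt (verit) of_nat_0_less_iff zero_less_power_int)
  have ne: "cbox u v \<noteq> {}"
    using le by (simp add: interval_ne_empty_cart)
  have "emeasure lborel (cbox u v) = ennreal ((real c powi (- j)) ^ CARD('n))"
    using content_cbox_cart[OF ne] uv(3) emeasure_lborel_cbox_finite[of u v] by (subst emeasure_eq_ennreal_measure) auto
  moreover from this have "emeasure lborel (box u v) = ennreal ((real c powi (- j)) ^ CARD('n))"
    by (simp add: emeasure_lborel_box_eq emeasure_lborel_cbox_eq)
  moreover have "box u v \<subseteq> interior (adic_cube c j x)"
    using uv(1) open_box by (rule interior_maximal)
  moreover have "emeasure lborel (box u v) \<le> emeasure lborel (interior (adic_cube c j x))"
    "emeasure lborel (interior (adic_cube c j x)) \<le> emeasure lborel (adic_cube c j x)"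
    "emeasure lborel (adic_cube c j x) \<le> emeasure lborel (cbox u v)"
    using uv \<open>box u v \<subseteq> interior _\<close> interior_subset[of "adic_cube c j x"] adic_cube_borel[of c j x]
    by (auto intro!: emeasure_mono)
  ultimately show "emeasure lborel (adic_cube c j x) = ennreal ((real c powi (- j)) ^ CARD('n))"
    "emeasure lborel (interior (adic_cube c j x)) = ennreal ((real c powi (- j)) ^ CARD('n))"
    by auto
qed

lemma adic_side_small:
  assumes "2 \<le> c" "0 < (e::real)"
  obtains m :: int where "\<And>j. m \<le> j \<Longrightarrow> real c powi (- j) < e"
proof -
  have "1 / real c < 1" "0 \<le> 1 / real c" using assms by auto
  then obtain n where n: "(1 / real c) ^ n < e"
    using real_arch_pow_inv assms(2) by blast
  show thesis
  proof (rule that)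
    fix j assume "int n \<le> j"
    then have "real c powi (- j) \<le> real c powi (- int n)"
      using assms by (intro power_int_increasing) auto
    also have "\<dots> = (1 / real c) ^ n" by (simp add: power_int_minus power_divide field_simps)
    finally show "real c powi (- j) < e" using n by simp
  qed
qed

lemma adic_cube_closure_subset:
  fixes x :: "real ^ 'n"
  assumes "2 \<le> c" "open W" "x \<in> W"
  obtains n :: nat where "closure (adic_cube c (m + int n) x) \<subseteq> W"
proof -
  obtain e where e: "0 < e" "cball x e \<subseteq> W" using assms by (meson open_contains_cball)
  obtain m' where m': "\<And>j. m' \<le> j \<Longrightarrow> real c powi (- j) < e / real CARD('n)"
    using adic_side_small[OF assms(1), of "e / real CARD('n)"] e by auto
  define n where "n = nat (m' - m)"
  have "adic_cube c (m + int n) x \<subseteq> cball x e"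
  proof
    fix y assume y: "y \<in> adic_cube c (m + int n) x"
    have "norm (x - y) \<le> real CARD('n) * real c powi (- (m + int n))"
      using assms by (intro adic_cube_norm_diff[OF _ adic_cube_self y]) auto
    also have "\<dots> \<le> e"
    proof -
      have "real c powi (- (m + int n)) < e / real CARD('n)" by (rule m') (simp add: n_def)
      then show ?thesis by (simp add: pos_less_divide_eq mult.commute)
    qed
    finally show "y \<in> cball x e" by (simp add: dist_norm)
  qed
  then have "closure (adic_cube c (m + int n) x) \<subseteq> W"
    using e closure_minimal closed_cball by blast
  then show thesis by (rule that)
qed

text \<open>The blocks are the maximal cubes of level at least \<open>m\<close> with closure in
  \<open>W\<close>. Asking for the closure is what later gives nested blocks a common point.\<close>

lemma adic_partition:
  fixes W :: "(real ^ 'n) set"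
  assumes "2 \<le> c" "open W"
  obtains \<A> where "\<A> \<subseteq> {adic_cube c j x | j x. m \<le> j}" "disjoint \<A>" "\<Union>\<A> = W"
    "\<forall>A\<in>\<A>. closure A \<subseteq> W"
proof -
  have c0: "0 < c" using assms by simp
  define n where "n x = (LEAST n. closure (adic_cube c (m + int n) x) \<subseteq> W)" for x
  have n: "closure (adic_cube c (m + int (n x)) x) \<subseteq> W" if "x \<in> W" for x
  proof -
    obtain i where "closure (adic_cube c (m + int i) x) \<subseteq> W"
      using adic_cube_closure_subset[OF assms \<open>x \<in> W\<close>] by blast
    then show ?thesis unfolding n_def by (rule LeastI)
  qed
  have n_le: "n x \<le> i" if "closure (adic_cube c (m + int i) x) \<subseteq> W" for x i
    unfolding n_def using that by (rule Least_le)
  let ?Q = "\<lambda>x. adic_cube c (m + int (n x)) x"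
  \<comment> \<open>The cube chosen at \<open>x\<close> is also the cube of that level at each of
    its points \<open>z\<close>, so the least admissible level at \<open>z\<close> is no larger.
    Applied in both directions this makes the two chosen cubes equal.\<close>
  have le: "?Q x \<subseteq> ?Q z" if "x \<in> W" "z \<in> ?Q x" for x z
  proof -
    have eq: "?Q x = adic_cube c (m + int (n x)) z" using adic_cube_eq[OF that(2)] by simp
    then have "n z \<le> n x" using n[OF that(1)] by (intro n_le) simp
    then show ?thesis unfolding eq by (intro adic_cube_mono c0) auto
  qed
  have eq: "?Q x = ?Q z" if "x \<in> W" "z \<in> ?Q x" for x z
  proof -
    have "x \<in> ?Q z" using le[OF that] adic_cube_self by blast
    moreover have "z \<in> W" using n[OF that(1)] that(2) closure_subset by blast
    ultimately show ?thesis using le that by blast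
  qed
  show thesis
  proof (rule that)
    show "?Q ` W \<subseteq> {adic_cube c j x | j x. m \<le> j}" by auto
    show "disjoint (?Q ` W)"
    proof (rule disjointI)
      fix A B assume AB: "A \<in> ?Q ` W" "B \<in> ?Q ` W" "A \<noteq> B"
      then obtain x y where xy: "x \<in> W" "A = ?Q x" "y \<in> W" "B = ?Q y" by blast
      show "A \<inter> B = {}"
      proof (rule ccontr)
        assume "A \<inter> B \<noteq> {}"
        then obtain z where "z \<in> ?Q x" "z \<in> ?Q y" using xy by blast
        then show False using eq[OF xy(1) \<open>z \<in> ?Q x\<close>] eq[OF xy(3) \<open>z \<in> ?Q y\<close>] xy AB(3) by simp
      qed
    qed
    show "\<Union>(?Q ` W) = W"
    proof (intro equalityI subsetI)
      fix y assume "y \<in> \<Union>(?Q ` W)"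
      then obtain x where "x \<in> W" "y \<in> ?Q x" by blast
      then show "y \<in> W" using n[of x] closure_subset[of "?Q x"] by auto
    next
      fix y assume "y \<in> W"
      then show "y \<in> \<Union>(?Q ` W)" using adic_cube_self by auto
    qed
    show "\<forall>A\<in>?Q ` W. closure A \<subseteq> W" using n by blast
  qed
qed

section \<open>Families of cubes and norms\<close>

text \<open>Encoding the sum as a measure lets it inherit countable additivity. Covers are handled
  as sets of cubes rather than sequences, so a repeated cube is paid once.\<close>

definition weight :: "('a \<Rightarrow> ennreal) \<Rightarrow> 'a set \<Rightarrow> ennreal" where
  "weight f A = emeasure (point_measure UNIV f) A"

lemma weight_eq: "weight f A = (\<integral>\<^sup>+x. f x \<partial>count_space A)"
  unfolding weight_def point_measure_def
  by (subst emeasure_density) (auto simp: nn_integral_count_space_indicator)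

lemma weight_mono: "A \<subseteq> B \<Longrightarrow> weight f A \<le> weight f B"
  unfolding weight_def by (rule emeasure_mono) (auto simp: sets_point_measure)

lemma weight_singleton: "weight f {x} = f x"
  by (simp add: weight_eq nn_integral_count_space_finite)

lemma weight_fun_mono: "(\<And>x. x \<in> A \<Longrightarrow> f x \<le> g x) \<Longrightarrow> weight f A \<le> weight g A"
  unfolding weight_eq by (rule nn_integral_mono) auto

lemma weight_UN:
  assumes "countable I" "disjoint_family_on X I"
  shows "weight f (\<Union>i\<in>I. X i) = weight (\<lambda>i. weight f (X i)) I"
  unfolding weight_eq[of "\<lambda>i. weight f (X i)"]
  unfolding weight_def by (rule emeasure_UN_countable) (use assms in \<open>auto simp: sets_point_measure\<close>)

lemma weight_Un_disjoint: "A \<inter> B = {} \<Longrightarrow> weight f (A \<union> B) = weight f A + weight f B"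
  unfolding weight_def by (rule plus_emeasure[symmetric]) (auto simp: sets_point_measure)

lemma weight_Un_le: "weight f (A \<union> B) \<le> weight f A + weight f B"
  unfolding weight_def by (rule emeasure_subadditive) (auto simp: sets_point_measure)

lemma weight_range_le: "weight f (range Q) \<le> (\<Sum>p. f (Q p))"
proof -
  have "weight f (range Q) = emeasure (point_measure UNIV f) (\<Union>p. {Q p})"
    unfolding weight_def by (simp add: UNION_singleton_eq_range)
  also have "\<dots> \<le> (\<Sum>p. emeasure (point_measure UNIV f) {Q p})"
    by (rule emeasure_subadditive_countably) (auto simp: sets_point_measure)
  also have "\<dots> = (\<Sum>p. f (Q p))"
    using weight_singleton[of f] by (simp add: weight_def)
  finally show ?thesis .
qed

text \<open>The exchange argument: a block not properly inside a member of \<open>\<C>\<close>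
  replaces the members of \<open>\<C>\<close> inside it. Disjoint blocks contain disjoint groups of
  members, so the comparisons add up and the total cost does not grow. The second price
  \<open>f'\<close> allows the new family to be measured by a multiple of the volume.\<close>

lemma replace_cover:
  fixes f f' :: "'a set \<Rightarrow> ennreal"
  assumes "countable \<A>" "disjoint \<A>" "{} \<notin> \<A>" "{} \<notin> \<C>"
    and le: "\<And>C. C \<in> \<C> \<Longrightarrow> f' C \<le> f C"
    and alt: "\<And>A. A \<in> \<A> \<Longrightarrow> (\<exists>C\<in>\<C>. A \<subseteq> C) \<or> f' A \<le> weight f {C \<in> \<C>. C \<subseteq> A}"
  shows "\<exists>\<D>. \<D> \<subseteq> \<C> \<union> \<A> \<and> \<Union>\<A> \<subseteq> \<Union>\<D> \<and> weight f' \<D> \<le> weight f \<C>"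
proof -
  define \<C>1 where "\<C>1 = {C \<in> \<C>. \<not> (\<exists>A\<in>\<A>. C \<subseteq> A)}"
  \<comment> \<open>The inclusion is proper: a block that is itself a member of \<open>\<C>\<close>
    was removed from \<open>\<C>1\<close> and has to reappear here.\<close>
  define \<A>1 where "\<A>1 = {A \<in> \<A>. \<not> (\<exists>C\<in>\<C>. A \<subset> C)}"
  have eqA: "A = B" if "A \<in> \<A>" "B \<in> \<A>" "C \<subseteq> A" "C \<subseteq> B" "C \<noteq> {}" for A B C
    using assms(2) that unfolding disjoint_def by blast
  have le1: "f' A \<le> weight f {C \<in> \<C>. C \<subseteq> A}" if A: "A \<in> \<A>1" for A
  proof (cases "A \<in> \<C>")
    \<comment> \<open>The first alternative of \<open>alt\<close> may hold through the block itself,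
      so the bound has to come from \<open>le\<close>.\<close>
    case True
    have "f' A \<le> weight f {A}" using le True by (simp add: weight_singleton)
    also have "\<dots> \<le> weight f {C \<in> \<C>. C \<subseteq> A}" using True by (intro weight_mono) auto
    finally show ?thesis .
  next
    case False
    then show ?thesis using alt[of A] A unfolding \<A>1_def by blast
  qed
  show ?thesis
  proof (intro exI[of _ "\<C>1 \<union> \<A>1"] conjI)
    show "\<C>1 \<union> \<A>1 \<subseteq> \<C> \<union> \<A>" by (auto simp: \<C>1_def \<A>1_def)
    show "\<Union>\<A> \<subseteq> \<Union>(\<C>1 \<union> \<A>1)"
    proof
      fix x assume "x \<in> \<Union>\<A>"
      then obtain A where A: "A \<in> \<A>" "x \<in> A" by blast
      show "x \<in> \<Union>(\<C>1 \<union> \<A>1)"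
      proof (cases "A \<in> \<A>1")
        case False
        then obtain C where C: "C \<in> \<C>" "A \<subset> C" using A by (auto simp: \<A>1_def)
        have "\<not> C \<subseteq> B" if "B \<in> \<A>" for B
        proof
          assume "C \<subseteq> B"
          then have "A = B" using C that A assms(3) by (intro eqA[of A B A]) auto
          then show False using C \<open>C \<subseteq> B\<close> by blast
        qed
        then have "C \<in> \<C>1" using C unfolding \<C>1_def by blast
        then show ?thesis using C A by blast
      qed (use A in blast)
    qed
    have "disjoint_family_on (\<lambda>A. {C \<in> \<C>. C \<subseteq> A}) \<A>1"
      unfolding disjoint_family_on_def
    proof (intro ballI impI)
      fix A B assume AB: "A \<in> \<A>1" "B \<in> \<A>1" "A \<noteq> B"
      have "C = {}" if "C \<subseteq> A" "C \<subseteq> B" for C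
        using eqA[of A B C] AB that unfolding \<A>1_def by blast
      then show "{C \<in> \<C>. C \<subseteq> A} \<inter> {C \<in> \<C>. C \<subseteq> B} = {}"
        using assms(4) by auto
    qed
    moreover have "countable \<A>1" using assms(1) unfolding \<A>1_def by (rule countable_subset[rotated]) auto
    ultimately have UN: "weight f (\<Union>A\<in>\<A>1. {C \<in> \<C>. C \<subseteq> A}) = weight (\<lambda>A. weight f {C \<in> \<C>. C \<subseteq> A}) \<A>1"
      by (intro weight_UN)
    have "weight f' (\<C>1 \<union> \<A>1) \<le> weight f' \<C>1 + weight f' \<A>1" by (rule weight_Un_le)
    also have "\<dots> \<le> weight f \<C>1 + weight (\<lambda>A. weight f {C \<in> \<C>. C \<subseteq> A}) \<A>1"
      by (intro add_mono weight_fun_mono) (auto simp: \<C>1_def le le1)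
    also have "\<dots> = weight f (\<C>1 \<union> (\<Union>A\<in>\<A>1. {C \<in> \<C>. C \<subseteq> A}))"
      unfolding UN[symmetric] by (rule weight_Un_disjoint[symmetric]) (auto simp: \<C>1_def \<A>1_def)
    also have "\<dots> \<le> weight f \<C>" by (intro weight_mono) (auto simp: \<C>1_def)
    finally show "weight f' (\<C>1 \<union> \<A>1) \<le> weight f \<C>" .
  qed
qed

section \<open>Comparison of the norm \<open>N\<close> with the Euclidean norm\<close>

lemma is_norm_le_norm:
  fixes N :: "'a::euclidean_space \<Rightarrow> real"
  assumes "is_norm N"
  obtains b where "0 < b" "\<And>x. N x \<le> b * norm x"
proof -
  have hom: "N (a *\<^sub>R x) = \<bar>a\<bar> * N x" and tri: "N (x + y) \<le> N x + N y" and nn: "0 \<le> N x" and "N 0 = 0" for a x y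
    using assms by (auto simp: is_norm_def)
  have sum: "N (sum f A) \<le> (\<Sum>i\<in>A. N (f i))" if "finite A" for f :: "'a \<Rightarrow> 'a" and A
    using that by (induction A) (auto simp: \<open>N 0 = 0\<close> intro: order_trans[OF tri])
  define b where "b = (\<Sum>i\<in>Basis. N i) + 1"
  show thesis
  proof (rule that)
    show "0 < b" unfolding b_def using sum_nonneg[of Basis N] nn by (simp add: add_nonneg_pos)
    show "N x \<le> b * norm x" for x
    proof -
      have "N x = N (\<Sum>i\<in>Basis. (x \<bullet> i) *\<^sub>R i)" by (simp add: euclidean_representation)
      also have "\<dots> \<le> (\<Sum>i\<in>Basis. N ((x \<bullet> i) *\<^sub>R i))" by (rule sum) simp
      also have "\<dots> \<le> (\<Sum>i\<in>Basis. norm x * N i)"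
        by (intro sum_mono) (simp add: hom mult_right_mono nn Basis_le_norm)
      also have "\<dots> \<le> b * norm x" by (simp add: b_def algebra_simps sum_distrib_left)
      finally show ?thesis .
    qed
  qed
qed

lemma is_norm_diff_le:
  assumes "is_norm N"
  shows "\<bar>N x - N y\<bar> \<le> N (x - y)"
proof -
  have hom: "N (a *\<^sub>R x) = \<bar>a\<bar> * N x" and tri: "N (x + y) \<le> N x + N y" for a x y
    using assms by (auto simp: is_norm_def)
  have "N (y - x) = N (x - y)" using hom[of "-1" "x - y"] by simp
  then show ?thesis using tri[of "x - y" y] tri[of "y - x" x] by simp
qed

lemma is_norm_continuous:
  fixes N :: "'a::euclidean_space \<Rightarrow> real"
  assumes "is_norm N"
  shows "continuous_on S N"
proof -
  obtain b where b: "0 < b" "\<And>x. N x \<le> b * norm x" using is_norm_le_norm[OF assms] by blast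
  have "b-lipschitz_on S N"
    using b is_norm_diff_le[OF assms] unfolding lipschitz_on_def
    by (auto simp: dist_norm intro: order_trans)
  then show ?thesis by (rule lipschitz_on_continuous_on)
qed

lemma norm_le_is_norm:
  fixes N :: "'a::euclidean_space \<Rightarrow> real"
  assumes "is_norm N"
  obtains a where "0 < a" "\<And>x. a * norm x \<le> N x"
proof -
  have hom: "N (a *\<^sub>R x) = \<bar>a\<bar> * N x" and nn: "0 \<le> N x" and N0: "N x = 0 \<longleftrightarrow> x = 0" for a x
    using assms by (auto simp: is_norm_def)
  have "sphere (0::'a) 1 \<noteq> {}" by simp
  then obtain z where z: "z \<in> sphere 0 1" "\<And>x. x \<in> sphere 0 1 \<Longrightarrow> N z \<le> N x"
    using continuous_attains_inf[OF compact_sphere _ is_norm_continuous[OF assms]] by blast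
  show thesis
  proof (rule that)
    show "0 < N z" using z(1) nn[of z] N0[of z] by (auto simp: less_le)
    show "N z * norm x \<le> N x" for x
    proof (cases "x = 0")
      case False
      then have "N z \<le> N (inverse (norm x) *\<^sub>R x)" by (intro z(2)) simp
      also have "\<dots> = inverse (norm x) * N x" by (simp add: hom)
      finally show ?thesis using False by (simp add: field_simps)
    qed (simp add: nn)
  qed
qed

text \<open>Translation and homogeneity reduce every cube to the unit cube, whose diameter is finite
  because \<open>N\<close> is bounded by a multiple of the Euclidean norm.\<close>

lemma diamN_adic_cube:
  fixes N :: "real ^ 'n \<Rightarrow> real"
  assumes "is_norm N" "0 < c"
  obtains D where "0 < D" "\<And>j x. diamN N (adic_cube c j x) = ennreal (real c powi (- j) * D)"
proof -
  have hom: "N (a *\<^sub>R x) = \<bar>a\<bar> * N x" and nn: "0 \<le> N x" and N0: "N x = 0 \<longleftrightarrow> x = 0" for a x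
    using assms by (auto simp: is_norm_def)
  obtain b where b: "0 < b" "\<And>x. N x \<le> b * norm x" using is_norm_le_norm[OF assms(1)] by blast
  let ?A = "{y :: real ^ 'n. \<forall>l. 0 \<le> y $ l \<and> y $ l < 1}"
  have A_eq: "?A = adic_cube c 0 0"
  proof -
    have "\<lfloor>t\<rfloor> = 0 \<longleftrightarrow> 0 \<le> t \<and> t < 1" for t :: real by linarith
    then show ?thesis by (simp add: adic_cube_def)
  qed
  define D where "D = enn2real (diamN N ?A)"
  have "diamN N ?A \<le> ennreal (b * real CARD('n))"
    unfolding diamN_def
  proof (intro SUP_least ennreal_leI)
    fix x y assume "x \<in> ?A" "y \<in> ?A"
    then have "norm (x - y) \<le> real CARD('n)"
      unfolding A_eq using adic_cube_norm_diff[OF assms(2), of x 0 0 y] by simp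
    then show "N (x - y) \<le> b * real CARD('n)"
      using b by (intro order_trans[OF b(2)] mult_left_mono) auto
  qed
  then have fin: "diamN N ?A = ennreal D"
    unfolding D_def by (intro ennreal_enn2real[symmetric]) (rule le_less_trans, auto)
  \<comment> \<open>This point and the origin both lie in the half-open unit cube, which therefore
    has positive diameter.\<close>
  let ?h = "(\<chi> l. 1/2) :: real ^ 'n"
  have "ennreal (N (?h - 0)) \<le> diamN N ?A"
    unfolding diamN_def by (intro SUP_upper2[of ?h] SUP_upper2[of 0]) auto
  moreover have "N (?h - 0) > 0" using nn[of ?h] N0[of ?h] by (auto simp: less_le vec_eq_iff)
  ultimately have "0 < D" unfolding fin by (metis ennreal_le_iff2 linorder_not_less order_less_le_trans)
  have "diamN N (adic_cube c j x) = ennreal (real c powi (- j) * D)" for j x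
  proof -
    define \<kappa> :: "int ^ 'n" where "\<kappa> = (\<chi> l. \<lfloor>real c powi j * x $ l\<rfloor>)"
    have Q: "adic_cube c j x = (\<lambda>y. (real c powi (- j)) *\<^sub>R ((\<chi> l. real_of_int (\<kappa> $ l)) + y)) ` ?A"
      unfolding adic_cube_image[OF assms(2)] by (simp add: adic_cube_def \<kappa>_def)
    let ?s = "real c powi (- j)"
    have s: "0 \<le> ?s" by simp
    have eq: "N (?s *\<^sub>R (k + y) - ?s *\<^sub>R (k + z)) = ?s * N (y - z)" for k y z :: "real ^ 'n"
      using hom[of ?s "y - z"] s by (simp add: scaleR_right_diff_distrib scaleR_right_distrib)
    have "diamN N (adic_cube c j x) = (SUP y\<in>?A. SUP z\<in>?A. ennreal ?s * ennreal (N (y - z)))"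
      unfolding Q diamN_def image_image eq by (simp add: ennreal_mult nn)
    also have "\<dots> = ennreal ?s * diamN N ?A"
      unfolding diamN_def by (simp add: SUP_mult_left_ennreal)
    also have "\<dots> = ennreal (?s * D)" using \<open>0 < D\<close> by (simp add: fin ennreal_mult)
    finally show ?thesis .
  qed
  then show thesis using that \<open>0 < D\<close> by blast
qed

section \<open>Net contents and sets of full content\<close>

text \<open>Passes from sets of cubes to the sequences in \<open>net_covers\<close>. Empty sets pad
  the sequence, hence the condition \<open>f {} = 0\<close>.\<close>

lemma countable_enumeration:
  assumes "countable \<D>"
  obtains A :: "nat \<Rightarrow> 'a set" where "range A \<subseteq> insert {} \<D>" "(\<Union>n. A n) = \<Union>\<D>"
    "\<And>f. f {} = 0 \<Longrightarrow> (\<Sum>n. f (A n)) = weight f \<D>"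
proof -
  let ?I = "to_nat_on \<D> ` \<D>"
  define A where "A n = (if n \<in> ?I then from_nat_into \<D> n else {})" for n
  have bij: "bij_betw (from_nat_into \<D>) ?I \<D>"
    by (rule bij_betwI[where g = "to_nat_on \<D>"]) (use assms in auto)
  have sub: "range A \<subseteq> insert {} \<D>"
    using assms by (auto simp: A_def)
  have Un: "(\<Union>n. A n) = \<Union>\<D>"
  proof (intro equalityI subsetI)
    fix x assume "x \<in> \<Union>\<D>"
    then obtain X where X: "X \<in> \<D>" "x \<in> X" by blast
    then have "A (to_nat_on \<D> X) = X" using assms by (simp add: A_def)
    then show "x \<in> (\<Union>n. A n)" using X by blast
  qed (use sub in blast)
  have sum: "(\<Sum>n. f (A n)) = weight f \<D>" if "f {} = 0" for f
  proof -
    have "(\<Sum>n. f (A n)) = (\<integral>\<^sup>+n. f (A n) \<partial>count_space UNIV)"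
      by (simp add: nn_integral_count_space_nat)
    also have "\<dots> = (\<integral>\<^sup>+n. f (from_nat_into \<D> n) * indicator ?I n \<partial>count_space UNIV)"
      by (intro nn_integral_cong) (simp add: A_def that)
    also have "\<dots> = (\<integral>\<^sup>+n. f (from_nat_into \<D> n) \<partial>count_space ?I)"
      by (simp add: nn_integral_count_space_indicator)
    also have "\<dots> = weight f \<D>"
      unfolding weight_eq by (rule nn_integral_bij_count_space[OF bij])
    finally show ?thesis .
  qed
  show thesis by (rule that[OF sub Un sum])
qed

text \<open>The measure is arbitrary because the bound serves both for the volume and for the volume
  restricted to a plate.\<close>

lemma emeasure_le_weight:
  assumes "countable \<D>" "\<D> \<subseteq> sets M" "S \<subseteq> \<Union>\<D>"
  shows "emeasure M S \<le> weight (emeasure M) \<D>"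
proof -
  obtain A :: "nat \<Rightarrow> 'a set" where A: "range A \<subseteq> insert {} \<D>" "(\<Union>n. A n) = \<Union>\<D>"
    "\<And>f. f {} = 0 \<Longrightarrow> (\<Sum>n. f (A n)) = weight f \<D>"
    using countable_enumeration[OF assms(1)] by metis
  have sets: "range A \<subseteq> sets M" using A(1) assms(2) by auto
  then have "(\<Union>n. A n) \<in> sets M" by (intro sets.countable_UN)
  then have "emeasure M S \<le> emeasure M (\<Union>n. A n)"
    using A(2) assms(3) by (intro emeasure_mono) auto
  also have "\<dots> \<le> (\<Sum>n. emeasure M (A n))"
    using sets by (rule emeasure_subadditive_countably)
  finally show ?thesis by (simp add: A(3))
qed

text \<open>The supremum defining \<open>gauge_eps\<close> need not be attained; the strict
  inequality yields an admissible interval reaching beyond \<open>t\<close>.\<close>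

lemma gauge_eps_less:
  assumes "t < gauge_eps e g" "g \<in> gauges e"
  obtains \<epsilon> where "t < \<epsilon>" "mono_on {0..\<epsilon>} g" "antimono_on {0<..\<epsilon>} (\<lambda>r. g r / r ^ e)"
proof -
  let ?S = "{\<epsilon>\<in>{0<..1}. mono_on {0..\<epsilon>} g \<and> antimono_on {0<..\<epsilon>} (\<lambda>r. g r / r ^ e)}"
  obtain \<epsilon> where \<epsilon>: "0 < \<epsilon>" "mono_on {0..\<epsilon>} g" "antimono_on {0<..\<epsilon>} (\<lambda>r. g r / r ^ e)"
    using assms(2) unfolding gauges_def by blast
  have "mono_on {0..min \<epsilon> 1} g" "antimono_on {0<..min \<epsilon> 1} (\<lambda>r. g r / r ^ e)"
    by (rule monotone_on_subset[OF \<epsilon>(2)] monotone_on_subset[OF \<epsilon>(3)]; auto)+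
  with \<epsilon>(1) have "min \<epsilon> 1 \<in> ?S" by simp
  then have ne: "?S \<noteq> {}" by blast
  have "t < Sup ?S" using assms(1) unfolding gauge_eps_def .
  then obtain y where y: "y \<in> ?S" "t < y"
    by (rule less_cSupE[OF _ ne])
  show thesis by (rule that[OF y(2)]) (use y(1) in auto)
qed

lemma gauge_eps_pos:
  assumes "g \<in> gauges e"
  shows "0 < gauge_eps e g"
proof -
  let ?S = "{\<epsilon>\<in>{0<..1}. mono_on {0..\<epsilon>} g \<and> antimono_on {0<..\<epsilon>} (\<lambda>r. g r / r ^ e)}"
  obtain \<epsilon> where \<epsilon>: "0 < \<epsilon>" "mono_on {0..\<epsilon>} g" "antimono_on {0<..\<epsilon>} (\<lambda>r. g r / r ^ e)"
    using assms unfolding gauges_def by blast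
  have "mono_on {0..min \<epsilon> 1} g" "antimono_on {0<..min \<epsilon> 1} (\<lambda>r. g r / r ^ e)"
    by (rule monotone_on_subset[OF \<epsilon>(2)] monotone_on_subset[OF \<epsilon>(3)]; auto)+
  with \<epsilon>(1) have "min \<epsilon> 1 \<in> ?S" by simp
  moreover have "bdd_above ?S" by (rule bdd_aboveI[of _ 1]) auto
  ultimately have "min \<epsilon> 1 \<le> gauge_eps e g"
    unfolding gauge_eps_def by (rule cSup_upper)
  then show ?thesis using \<epsilon>(1) by linarith
qed

lemma
  assumes "g \<in> gauges e" "t < gauge_eps e g"
  shows gauge_mono: "0 \<le> s \<Longrightarrow> s \<le> t \<Longrightarrow> g s \<le> g t"
    and gauge_ratio: "0 < s \<Longrightarrow> s \<le> t \<Longrightarrow> g t / t ^ e \<le> g s / s ^ e"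
    and gauge_pos: "0 < t \<Longrightarrow> 0 < g t"
proof -
  obtain \<epsilon> where \<epsilon>: "t < \<epsilon>" "mono_on {0..\<epsilon>} g" "antimono_on {0<..\<epsilon>} (\<lambda>r. g r / r ^ e)"
    using gauge_eps_less[OF assms(2,1)] .
  show m: "g s \<le> g t" if "0 \<le> s" "s \<le> t" for s
    using that \<epsilon> by (intro mono_onD[OF \<epsilon>(2)]) auto
  show "g t / t ^ e \<le> g s / s ^ e" if "0 < s" "s \<le> t" for s
    using that \<epsilon> by (intro monotone_onD[OF \<epsilon>(3)]) auto
  show "0 < g t" if "0 < t"
  proof -
    \<comment> \<open>Positivity is assumed only near zero; monotonicity carries it up to
      \<open>t\<close>.\<close>
    obtain \<delta> where \<delta>: "0 < \<delta>" "\<And>r. r \<in> {0<..\<delta>} \<Longrightarrow> 0 < g r / r ^ e"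
      using assms(1) unfolding gauges_def by blast
    have "0 < g (min \<delta> t) / (min \<delta> t) ^ e" using \<delta> that by simp
    moreover have "0 < (min \<delta> t) ^ e" using \<delta> that by simp
    ultimately have "0 < g (min \<delta> t)" by (simp add: pos_less_divide_eq)
    also have "\<dots> \<le> g t" using \<delta> that by (intro m) auto
    finally show ?thesis .
  qed
qed

section \<open>Cubes and their prices for a fixed gauge\<close>

locale net_gauge =
  fixes N :: "real ^ 'n \<Rightarrow> real" and c :: nat and g :: "real \<Rightarrow> real"
  assumes norm: "is_norm N" and c2: "2 \<le> c" and gauge: "g \<in> gauges CARD('n)"
begin

definition diam_unit :: real where "diam_unit = enn2real (diamN N (adic_cube c 0 0))"

definition small_cubes :: "(real ^ 'n) set set" where
  "small_cubes = {C \<in> adic_cubes c. diamN N C < ennreal (gauge_eps CARD('n) g)}"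

definition price :: "(real ^ 'n) set \<Rightarrow> ennreal" where
  "price C = ennreal (g (enn2real (diamN N C)))"

lemma c0: "0 < c" using c2 by simp

lemma diam_unit_pos: "0 < diam_unit"
  and diam_cube: "diamN N (adic_cube c j x) = ennreal (real c powi (- j) * diam_unit)"
proof -
  obtain D where D: "0 < D" "\<And>j x. diamN N (adic_cube c j x) = ennreal (real c powi (- j) * D)"
    using diamN_adic_cube[OF norm c0] by metis
  then have "diam_unit = D" by (simp add: diam_unit_def)
  then show "0 < diam_unit" "diamN N (adic_cube c j x) = ennreal (real c powi (- j) * diam_unit)"
    using D by auto
qed

lemma side_pos: "0 < real c powi j"
  using c0 by simp

lemma price_cube: "price (adic_cube c j x) = ennreal (g (real c powi (- j) * diam_unit))"
  unfolding price_def diam_cube using diam_unit_pos by (subst enn2real_ennreal) auto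

lemma small_cube_iff:
  "adic_cube c j x \<in> small_cubes \<longleftrightarrow> real c powi (- j) * diam_unit < gauge_eps CARD('n) g"
  unfolding small_cubes_def using c0 diam_unit_pos
  by (auto simp: diam_cube adic_cube_in ennreal_less_iff)

lemma small_cubeE:
  assumes "C \<in> small_cubes"
  obtains j x where "C = adic_cube c j x"
  using assms unfolding small_cubes_def adic_cubes_eq[OF c0] by blast

lemma small_cubes_adic: "C \<in> small_cubes \<Longrightarrow> C \<in> adic_cubes c"
  by (simp add: small_cubes_def)

lemma countable_small: "\<C> \<subseteq> small_cubes \<Longrightarrow> countable \<C>"
  by (rule countable_subset[OF _ countable_adic_cubes]) (auto dest: small_cubes_adic)

lemma empty_notin_small: "{} \<notin> small_cubes"
  using small_cubes_adic adic_cubes_nonempty[OF c0] by blast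

lemma small_nested:
  "C \<in> small_cubes \<Longrightarrow> D \<in> small_cubes \<Longrightarrow> z \<in> C \<Longrightarrow> z \<in> D \<Longrightarrow> C \<subseteq> D \<or> D \<subseteq> C"
  by (rule adic_cubes_nested[OF c0]) (auto dest: small_cubes_adic)

lemma small_level: obtains m where "\<And>j x. m \<le> j \<Longrightarrow> adic_cube c j x \<in> small_cubes"
proof -
  have "0 < gauge_eps CARD('n) g / diam_unit"
    using gauge_eps_pos[OF gauge] diam_unit_pos by simp
  then obtain m :: int where "\<And>j. m \<le> j \<Longrightarrow> real c powi (- j) < gauge_eps CARD('n) g / diam_unit"
    using adic_side_small[OF c2] by metis
  then show thesis
    using that[of m] diam_unit_pos by (simp add: small_cube_iff pos_less_divide_eq)
qed

lemma net_content_le: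
  assumes "\<C> \<subseteq> small_cubes" "F \<subseteq> \<Union>\<C>"
  shows "net_content N c g F \<le> weight price \<C>"
proof -
  obtain A :: "nat \<Rightarrow> (real ^ 'n) set" where A: "range A \<subseteq> insert {} \<C>" "(\<Union>n. A n) = \<Union>\<C>"
    "\<And>f. f {} = 0 \<Longrightarrow> (\<Sum>n. f (A n)) = weight f \<C>"
    using countable_enumeration[OF countable_small[OF assms(1)]] by metis
  have "A \<in> net_covers N c g F"
    unfolding net_covers_def mem_Collect_eq
  proof (intro conjI allI)
    show "F \<subseteq> (\<Union>p. A p)" using A(2) assms(2) by simp
    fix p
    have "A p \<in> insert {} small_cubes" using A(1) assms(1) by auto
    then show "A p = {} \<or> (A p \<in> adic_cubes c \<and> diamN N (A p) < ennreal (gauge_eps CARD('n) g))"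
      by (auto simp: small_cubes_def)
  qed
  then have "net_content N c g F \<le> (\<Sum>p. price (A p))"
    unfolding net_content_def price_def by (rule INF_lower)
  also have "price {} = 0"
    using gauge by (simp add: price_def diamN_def gauges_def bot_ennreal)
  then have "(\<Sum>p. price (A p)) = weight price \<C>" by (rule A(3))
  finally show ?thesis .
qed

text \<open>Together with \<open>net_content_le\<close> this presents the content as an infimum over
  sets of small cubes: dropping the empty members and the repetitions of a sequence never raises its
  cost.\<close>

lemma net_content_ge:
  assumes "\<And>\<C>. \<C> \<subseteq> small_cubes \<Longrightarrow> F \<subseteq> \<Union>\<C> \<Longrightarrow> x \<le> weight price \<C>"
  shows "x \<le> net_content N c g F"
  unfolding net_content_def
proof (rule INF_greatest)
  fix Q assume Q: "Q \<in> net_covers N c g F"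
  let ?C = "range Q \<inter> small_cubes"
  have "F \<subseteq> \<Union>?C"
  proof
    fix x assume "x \<in> F"
    then obtain p where p: "x \<in> Q p" using Q unfolding net_covers_def by blast
    then have "Q p \<in> small_cubes"
      using Q unfolding net_covers_def small_cubes_def mem_Collect_eq by (metis empty_iff)
    then show "x \<in> \<Union>?C" using p by blast
  qed
  then have "x \<le> weight price ?C" by (intro assms) auto
  also have "\<dots> \<le> weight price (range Q)" by (rule weight_mono) auto
  also have "\<dots> \<le> (\<Sum>p. price (Q p))" by (rule weight_range_le)
  finally show "x \<le> (\<Sum>p. ennreal (g (enn2real (diamN N (Q p)))))" by (simp add: price_def)
qed

text \<open>\<open>K\<close> is the price of \<open>Q\<close> per unit volume. Since g(t) / t^d is
  nonincreasing, smaller cubes cost at least as much per unit volume, so \<open>K\<close> times the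
  volume is an additive lower bound for prices that is exact on \<open>Q\<close>.\<close>

lemma price_density:
  assumes "Q \<in> small_cubes"
  obtains K :: real where "0 < K" "price Q = ennreal K * emeasure lborel Q"
    "\<And>C. C \<in> small_cubes \<Longrightarrow> C \<subseteq> Q \<Longrightarrow> ennreal K * emeasure lborel C \<le> price C"
proof -
  let ?d = "CARD('n)"
  obtain q y where Q: "Q = adic_cube c q y" using small_cubeE[OF assms] .
  define b where "b = real c powi (- q)"
  have b: "0 < b" "b * diam_unit < gauge_eps ?d g"
    using assms by (auto simp: Q small_cube_iff b_def side_pos)
  have D: "0 < diam_unit" by (rule diam_unit_pos)
  define K where "K = g (b * diam_unit) / b ^ ?d"
  have "0 < g (b * diam_unit)" using gauge_pos[OF gauge b(2)] b D by simp
  then have K: "0 < K" using b by (simp add: K_def)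
  show thesis
  proof (rule that[OF K])
    have "price Q = ennreal (K * b ^ ?d)"
      using b by (simp add: Q price_cube K_def flip: b_def)
    then show "price Q = ennreal K * emeasure lborel Q"
      using K b by (simp add: Q emeasure_adic_cube[OF c0] ennreal_mult flip: b_def)
    fix C assume C: "C \<in> small_cubes" "C \<subseteq> Q"
    obtain i x where C_eq: "C = adic_cube c i x" using small_cubeE[OF C(1)] .
    define a where "a = real c powi (- i)"
    have a: "0 < a" by (simp add: a_def side_pos)
    have "emeasure lborel C \<le> emeasure lborel Q"
      using C(2) by (intro emeasure_mono) (auto simp: Q adic_cube_borel)
    then have "ennreal (a ^ ?d) \<le> ennreal (b ^ ?d)"
      by (simp add: Q C_eq emeasure_adic_cube[OF c0] flip: a_def b_def)
    then have "a ^ ?d \<le> b ^ ?d" using b by (simp add: ennreal_le_iff)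
    then have ab: "a \<le> b" using a b by (simp add: power_mono_iff)
    have "g (b * diam_unit) / (b * diam_unit) ^ ?d \<le> g (a * diam_unit) / (a * diam_unit) ^ ?d"
      using gauge_ratio[OF gauge b(2)] a ab D by simp
    then have "K \<le> g (a * diam_unit) / a ^ ?d"
      using D by (simp add: K_def power_mult_distrib divide_le_cancel flip: divide_divide_eq_left)
    then have "K * a ^ ?d \<le> g (a * diam_unit)" using a by (simp add: pos_le_divide_eq)
    then show "ennreal K * emeasure lborel C \<le> price C"
      using K a by (simp add: C_eq price_cube emeasure_adic_cube[OF c0] ennreal_mult[symmetric] ennreal_leI flip: a_def)
  qed
qed

text \<open>A local form of equality of contents, with covers by cubes inside \<open>Q\<close> only.
  Asking that just \<open>W \<inter> interior Q\<close> be covered lets an adic partition of this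
  open set compete as a cover in \<open>full_content_step\<close>.\<close>

definition full_content :: "(real ^ 'n) set \<Rightarrow> (real ^ 'n) set \<Rightarrow> bool" where
  "full_content W V \<longleftrightarrow> (\<forall>Q\<in>small_cubes. Q \<subseteq> V \<longrightarrow>
     (\<forall>\<C>\<subseteq>small_cubes. (\<forall>C\<in>\<C>. C \<subseteq> Q) \<longrightarrow> W \<inter> interior Q \<subseteq> \<Union>\<C> \<longrightarrow> price Q \<le> weight price \<C>))"

text \<open>The cube \<open>Q\<close>, and with it its price per unit volume \<open>K\<close>, is
  fixed before any subdivision, so a threshold \<open>m\<close> depending on \<open>K\<close> is
  enough. Beyond it, members of a cover are exchanged for whole subcubes priced at \<open>K\<close>
  times their volume, and subadditivity of the volume recovers the price of
  \<open>Q\<close>.\<close>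

lemma full_contentI:
  assumes "\<And>K. 0 < K \<Longrightarrow> \<exists>m. \<forall>j\<ge>m. \<forall>x. adic_cube c j x \<subseteq> V \<longrightarrow>
     (\<forall>\<C>\<subseteq>small_cubes. (\<forall>C\<in>\<C>. C \<subseteq> adic_cube c j x) \<longrightarrow> W \<inter> interior (adic_cube c j x) \<subseteq> \<Union>\<C> \<longrightarrow>
        ennreal K * emeasure lborel (adic_cube c j x) \<le> weight price \<C>)"
  shows "full_content W V"
  unfolding full_content_def
proof (intro ballI impI allI)
  fix Q \<C> assume Q: "Q \<in> small_cubes" "Q \<subseteq> V"
    and \<C>: "\<C> \<subseteq> small_cubes" "\<forall>C\<in>\<C>. C \<subseteq> Q" "W \<inter> interior Q \<subseteq> \<Union>\<C>"
  obtain q y where Q_eq: "Q = adic_cube c q y" using small_cubeE[OF Q(1)] .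
  obtain K :: real where K: "0 < K" "price Q = ennreal K * emeasure lborel Q"
    "\<And>C. C \<in> small_cubes \<Longrightarrow> C \<subseteq> Q \<Longrightarrow> ennreal K * emeasure lborel C \<le> price C"
    using price_density[OF Q(1)] by metis
  obtain m where m0: "\<forall>j\<ge>m. \<forall>x. adic_cube c j x \<subseteq> V \<longrightarrow>
     (\<forall>\<C>\<subseteq>small_cubes. (\<forall>C\<in>\<C>. C \<subseteq> adic_cube c j x) \<longrightarrow> W \<inter> interior (adic_cube c j x) \<subseteq> \<Union>\<C> \<longrightarrow>
        ennreal K * emeasure lborel (adic_cube c j x) \<le> weight price \<C>)"
    using assms[OF K(1)] ..
  have m: "m \<le> j \<Longrightarrow> adic_cube c j x \<subseteq> V \<Longrightarrow> \<C> \<subseteq> small_cubes \<Longrightarrow>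
      \<forall>C\<in>\<C>. C \<subseteq> adic_cube c j x \<Longrightarrow> W \<inter> interior (adic_cube c j x) \<subseteq> \<Union>\<C> \<Longrightarrow>
        ennreal K * emeasure lborel (adic_cube c j x) \<le> weight price \<C>" for j x \<C>
    using m0 by blast
  \<comment> \<open>Level \<open>q\<close> keeps the blocks inside \<open>Q\<close>; level
    \<open>m\<close> makes the hypothesis applicable to them.\<close>
  define j where "j = max m q"
  define \<A> where "\<A> = adic_cube c j ` Q"
  have sub: "A \<subseteq> Q" if "A \<in> \<A>" for A
  proof -
    obtain x where x: "A = adic_cube c j x" "x \<in> Q" using \<open>A \<in> \<A>\<close> unfolding \<A>_def by blast
    then have "Q = adic_cube c q x" using adic_cube_eq Q_eq by blast
    then show ?thesis using x adic_cube_mono[OF c0, of q j x] by (simp add: j_def)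
  qed
  have adic: "A \<in> adic_cubes c" if "A \<in> \<A>" for A
    using that adic_cube_in[OF c0] unfolding \<A>_def by blast
  have "countable \<A>"
    using adic countable_subset countable_adic_cubes by (metis subsetI)
  have "disjoint \<A>"
  proof (rule disjointI)
    fix A B assume "A \<in> \<A>" "B \<in> \<A>" "A \<noteq> B"
    then show "A \<inter> B = {}" unfolding \<A>_def using adic_cube_eq by blast
  qed
  have "\<exists>\<D>. \<D> \<subseteq> \<C> \<union> \<A> \<and> \<Union>\<A> \<subseteq> \<Union>\<D> \<and> weight (\<lambda>C. ennreal K * emeasure lborel C) \<D> \<le> weight price \<C>"
  proof (rule replace_cover[of \<A> \<C> "\<lambda>C. ennreal K * emeasure lborel C" price])
    show "{} \<notin> \<A>" using adic adic_cubes_nonempty[OF c0] by blast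
    show "{} \<notin> \<C>" using \<C>(1) empty_notin_small by blast
    show "ennreal K * emeasure lborel C \<le> price C" if "C \<in> \<C>" for C
      using K(3) \<C> that by blast
    show "(\<exists>C\<in>\<C>. A \<subseteq> C) \<or> ennreal K * emeasure lborel A \<le> weight price {C \<in> \<C>. C \<subseteq> A}"
      if A: "A \<in> \<A>" for A
    proof (rule disjCI)
      assume *: "\<not> ennreal K * emeasure lborel A \<le> weight price {C \<in> \<C>. C \<subseteq> A}"
      obtain x where x: "A = adic_cube c j x" using A unfolding \<A>_def by blast
      \<comment> \<open>If the members inside \<open>A\<close> are too cheap, they miss a point of
        \<open>W\<close> in the interior of \<open>A\<close>. The member covering that point is
        nested with \<open>A\<close> but not inside it, so it contains \<open>A\<close>.\<close>
      have "\<not> W \<inter> interior A \<subseteq> \<Union>{C \<in> \<C>. C \<subseteq> A}"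
      proof
        assume W: "W \<inter> interior A \<subseteq> \<Union>{C \<in> \<C>. C \<subseteq> A}"
        have "A \<subseteq> V" using sub[OF A] Q(2) by blast
        moreover have "{C \<in> \<C>. C \<subseteq> A} \<subseteq> small_cubes" using \<C>(1) by blast
        moreover have "m \<le> j" by (simp add: j_def)
        ultimately have "ennreal K * emeasure lborel A \<le> weight price {C \<in> \<C>. C \<subseteq> A}"
          using m[of j x "{C \<in> \<C>. C \<subseteq> A}"] W unfolding x[symmetric] by blast
        with * show False ..
      qed
      then obtain z where z: "z \<in> W" "z \<in> interior A" "z \<notin> \<Union>{C \<in> \<C>. C \<subseteq> A}" by blast
      moreover have "z \<in> interior Q" using z(2) interior_mono[OF sub[OF A]] by blast
      ultimately obtain C where C: "C \<in> \<C>" "z \<in> C" using \<C>(3) by blast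
      have "z \<in> A" using z(2) interior_subset by blast
      then have "A \<subseteq> C \<or> C \<subseteq> A"
        using C \<C>(1) adic[OF A] small_cubes_adic by (intro adic_cubes_nested[OF c0]) auto
      then show "\<exists>C\<in>\<C>. A \<subseteq> C" using C z(3) by blast
    qed
  qed fact+
  then obtain \<D> where \<D>: "\<D> \<subseteq> \<C> \<union> \<A>" "\<Union>\<A> \<subseteq> \<Union>\<D>"
    "weight (\<lambda>C. ennreal K * emeasure lborel C) \<D> \<le> weight price \<C>" by blast
  have "Q \<subseteq> \<Union>\<A>" unfolding \<A>_def using adic_cube_self by blast
  then have Q\<D>: "Q \<subseteq> \<Union>\<D>" using \<D>(2) by blast
  have "\<D> \<subseteq> adic_cubes c" using \<D>(1) \<C>(1) adic small_cubes_adic by blast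
  then have "emeasure lborel Q \<le> weight (emeasure lborel) \<D>"
    using adic_cubes_borel[OF c0] Q\<D> countable_subset[OF _ countable_adic_cubes]
    by (intro emeasure_le_weight) auto
  then have "price Q \<le> ennreal K * weight (emeasure lborel) \<D>"
    unfolding K(2) by (intro mult_left_mono) auto
  also have "\<dots> = weight (\<lambda>C. ennreal K * emeasure lborel C) \<D>"
    unfolding weight_eq by (rule nn_integral_cmult[symmetric]) simp
  also have "\<dots> \<le> weight price \<C>" by (rule \<D>(3))
  finally show "price Q \<le> weight price \<C>" .
qed

text \<open>If every block of a partition of \<open>W \<inter> interior ?Q\<close> were contained in
  a member of \<open>\<C>\<close> or paid for by the members inside it, the exchange would cover
  this set for less than the price of \<open>?Q\<close>, against \<open>full_content\<close>. A
  block violating both alternatives is the next cube.\<close>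

lemma full_content_step:
  assumes "open W" "full_content W V" "\<C> \<subseteq> small_cubes"
    and Q: "adic_cube c q y \<in> small_cubes" "adic_cube c q y \<subseteq> V"
    and nC: "\<not> (\<exists>C\<in>\<C>. adic_cube c q y \<subseteq> C)"
    and less: "weight price {C \<in> \<C>. C \<subseteq> adic_cube c q y} < price (adic_cube c q y)"
  obtains i x where "q < i" "adic_cube c i x \<in> small_cubes"
    "closure (adic_cube c i x) \<subseteq> W \<inter> interior (adic_cube c q y)"
    "\<not> (\<exists>C\<in>\<C>. adic_cube c i x \<subseteq> C)"
    "weight price {C \<in> \<C>. C \<subseteq> adic_cube c i x} < price (adic_cube c i x)"
proof -
  let ?Q = "adic_cube c q y"
  let ?\<C>Q = "{C \<in> \<C>. C \<subseteq> ?Q}"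
  obtain m where m: "\<And>j x. m \<le> j \<Longrightarrow> adic_cube c j x \<in> small_cubes" using small_level by metis
  have "open (W \<inter> interior ?Q)" using assms(1) by auto
  \<comment> \<open>\<open>m\<close> keeps the blocks small; \<open>q + 1\<close> makes the levels
    of successive cubes strictly increase.\<close>
  then obtain \<A> where \<A>: "\<A> \<subseteq> {adic_cube c j x | j x. max m (q + 1) \<le> j}" "disjoint \<A>"
    "\<Union>\<A> = W \<inter> interior ?Q" "\<forall>A\<in>\<A>. closure A \<subseteq> W \<inter> interior ?Q"
    by (rule adic_partition[OF c2])
  have \<A>_small: "\<A> \<subseteq> small_cubes" using \<A>(1) m by auto
  have subQ: "A \<subseteq> ?Q" if "A \<in> \<A>" for A
    using \<A>(3) that interior_subset[of ?Q] by blast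
  show thesis
  proof (cases "\<exists>A\<in>\<A>. \<not> (\<exists>C\<in>\<C>. A \<subseteq> C) \<and> weight price {C \<in> \<C>. C \<subseteq> A} < price A")
    case True
    then obtain A where A: "A \<in> \<A>" "\<not> (\<exists>C\<in>\<C>. A \<subseteq> C)" "weight price {C \<in> \<C>. C \<subseteq> A} < price A"
      by blast
    have "A \<in> {adic_cube c j x | j x. max m (q + 1) \<le> j}" using A(1) \<A>(1) by (rule rev_subsetD)
    then obtain i x where i: "A = adic_cube c i x" "max m (q + 1) \<le> i" by blast
    show thesis
    proof (rule that)
      show "q < i" using i(2) by simp
      show "adic_cube c i x \<in> small_cubes" using A(1) \<A>_small i(1) by blast
      show "closure (adic_cube c i x) \<subseteq> W \<inter> interior ?Q" using A(1) \<A>(4) i(1) by blast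
    qed (use A(2,3) i(1) in auto)
  next
    case False
    have "\<exists>\<D>. \<D> \<subseteq> ?\<C>Q \<union> \<A> \<and> \<Union>\<A> \<subseteq> \<Union>\<D> \<and> weight price \<D> \<le> weight price ?\<C>Q"
    proof (rule replace_cover[of \<A> ?\<C>Q price price])
      show "countable \<A>" using \<A>_small by (rule countable_small)
      show "{} \<notin> \<A>" "{} \<notin> ?\<C>Q" using empty_notin_small \<A>_small assms(3) by auto
      show "(\<exists>C\<in>?\<C>Q. A \<subseteq> C) \<or> price A \<le> weight price {C \<in> ?\<C>Q. C \<subseteq> A}" if A: "A \<in> \<A>" for A
      proof (cases "\<exists>C\<in>\<C>. A \<subseteq> C")
        case True
        then obtain C where C: "C \<in> \<C>" "A \<subseteq> C" by blast
        have "A \<noteq> {}" using A \<A>_small empty_notin_small by auto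
        then obtain z where "z \<in> A" by blast
        \<comment> \<open>The inclusion \<open>?Q \<subseteq> C\<close> is excluded by
          \<open>nC\<close>, so \<open>C\<close> belongs to the family \<open>?\<C>Q\<close> that is
          being exchanged.\<close>
        then have "C \<subseteq> ?Q \<or> ?Q \<subseteq> C"
          using C A subQ assms(3) Q(1) by (intro small_nested) auto
        then show ?thesis using nC C by blast
      next
        case 2: False
        have "{C \<in> ?\<C>Q. C \<subseteq> A} = {C \<in> \<C>. C \<subseteq> A}" using subQ[OF A] by blast
        then show ?thesis using 2 False A by (metis linorder_not_less)
      qed
    qed (use \<A>(2) in auto)
    then obtain \<D> where \<D>: "\<D> \<subseteq> ?\<C>Q \<union> \<A>" "\<Union>\<A> \<subseteq> \<Union>\<D>" "weight price \<D> \<le> weight price ?\<C>Q"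
      by blast
    have "price ?Q \<le> weight price \<D>"
    proof -
      have "\<D> \<subseteq> small_cubes" using \<D>(1) \<A>_small assms(3) by blast
      moreover have "\<forall>C\<in>\<D>. C \<subseteq> ?Q" using \<D>(1) subQ by blast
      moreover have "W \<inter> interior ?Q \<subseteq> \<Union>\<D>" using \<D>(2) \<A>(3) by simp
      ultimately show ?thesis using assms(2) Q unfolding full_content_def by blast
    qed
    then show thesis using \<D>(3) less by simp
  qed
qed

text \<open>Iterating \<open>full_content_step\<close> shrinks cubes to a point. Cheapness alone
  would not keep that point uncovered; the invariant that no cube of the sequence lies inside a
  member of \<open>\<C>\<close> does.\<close>

lemma full_content_Inter_point:
  fixes W :: "nat \<Rightarrow> (real ^ 'n) set"
  assumes "\<And>n. open (W n)" "\<And>n. full_content (W n) V" "\<C> \<subseteq> small_cubes"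
    and Q: "Q \<in> small_cubes" "Q \<subseteq> V" "\<not> (\<exists>C\<in>\<C>. Q \<subseteq> C)" "weight price {C \<in> \<C>. C \<subseteq> Q} < price Q"
  obtains x where "x \<in> Q" "x \<in> (\<Inter>n. W n)" "x \<notin> \<Union>\<C>"
proof -
  obtain q y where Q_eq: "Q = adic_cube c q y" using small_cubeE[OF Q(1)] .
  define ok where "ok = (\<lambda>(i, x). adic_cube c i x \<in> small_cubes \<and> adic_cube c i x \<subseteq> V \<and>
     \<not> (\<exists>C\<in>\<C>. adic_cube c i x \<subseteq> C) \<and> weight price {C \<in> \<C>. C \<subseteq> adic_cube c i x} < price (adic_cube c i x))"
  have "\<exists>f. \<forall>n. (ok (f n) \<and> (n = 0 \<longrightarrow> f n = (q, y))) \<and>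
    (fst (f n) < fst (f (Suc n)) \<and>
      closure (adic_cube c (fst (f (Suc n))) (snd (f (Suc n)))) \<subseteq> W n \<inter> interior (adic_cube c (fst (f n)) (snd (f n))))"
  proof (rule dependent_nat_choice[where P = "\<lambda>n p. ok p \<and> (n = 0 \<longrightarrow> p = (q, y))" and
        Q = "\<lambda>n p p'. fst p < fst p' \<and>
          closure (adic_cube c (fst p') (snd p')) \<subseteq> W n \<inter> interior (adic_cube c (fst p) (snd p))"])
    show "\<exists>p. ok p \<and> (0 = (0::nat) \<longrightarrow> p = (q, y))" using Q by (simp add: ok_def Q_eq)
    fix p and n :: nat assume "ok p \<and> (n = 0 \<longrightarrow> p = (q, y))"
    then obtain i x where p: "p = (i, x)" and ok: "adic_cube c i x \<in> small_cubes" "adic_cube c i x \<subseteq> V"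
     "\<not> (\<exists>C\<in>\<C>. adic_cube c i x \<subseteq> C)" "weight price {C \<in> \<C>. C \<subseteq> adic_cube c i x} < price (adic_cube c i x)"
      by (cases p) (auto simp: ok_def)
    obtain i' x' where *: "i < i'" "adic_cube c i' x' \<in> small_cubes"
      "closure (adic_cube c i' x') \<subseteq> W n \<inter> interior (adic_cube c i x)"
      "\<not> (\<exists>C\<in>\<C>. adic_cube c i' x' \<subseteq> C)"
      "weight price {C \<in> \<C>. C \<subseteq> adic_cube c i' x'} < price (adic_cube c i' x')"
      using full_content_step[OF assms(1,2,3) ok, of n] .
    moreover have "adic_cube c i' x' \<subseteq> V"
      using *(3) ok(2) closure_subset[of "adic_cube c i' x'"] interior_subset[of "adic_cube c i x"] by blast
    ultimately show "\<exists>p'. (ok p' \<and> (Suc n = 0 \<longrightarrow> p' = (q, y))) \<and> fst p < fst p' \<and>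
      closure (adic_cube c (fst p') (snd p')) \<subseteq> W n \<inter> interior (adic_cube c (fst p) (snd p))"
      by (intro exI[of _ "(i', x')"]) (auto simp: ok_def p)
  qed
  then obtain f where f: "\<And>n. ok (f n)" "f 0 = (q, y)" "\<And>n. fst (f n) < fst (f (Suc n))"
    and cl: "\<And>n. closure (adic_cube c (fst (f (Suc n))) (snd (f (Suc n)))) \<subseteq>
      W n \<inter> interior (adic_cube c (fst (f n)) (snd (f n)))"
    by blast
  define R where "R n = adic_cube c (fst (f n)) (snd (f n))" for n
  have cl: "closure (R (Suc n)) \<subseteq> W n \<inter> interior (R n)" for n
    using cl by (simp add: R_def)
  obtain x where x: "\<And>n. x \<in> closure (R n)"
  proof (rule bounded_closed_nest[of "\<lambda>n. closure (R n)"])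
    show "closure (R n) \<noteq> {}" for n using adic_cube_self by (auto simp: R_def)
    show "closure (R n) \<subseteq> closure (R m)" if "m \<le> n" for m n
      using that
    proof (rule lift_Suc_antimono_le[of "\<lambda>n. closure (R n)", rotated])
      show "closure (R (Suc n)) \<subseteq> closure (R n)" for n
        using cl[of n] interior_subset[of "R n"] closure_subset[of "R n"] by blast
    qed
    obtain u v where "R 0 \<subseteq> cbox u v"
      unfolding R_def using adic_cube_box[OF c0] by metis
    then show "bounded (closure (R 0))"
      using bounded_cbox bounded_subset bounded_closure by metis
  qed auto
  \<comment> \<open>The shift by one matters: the closure of \<open>R (Suc n)\<close> lies in
    \<open>W n\<close> and in \<open>R n\<close> itself, so the point belongs to the half-open cubes
    and not only to their closures.\<close>
  have xR: "x \<in> R n" and xW: "x \<in> W n" for n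
    using x[of "Suc n"] cl[of n] interior_subset[of "R n"] by blast+
  \<comment> \<open>A member containing \<open>x\<close> is the cube of some level \<open>l\<close>
    around \<open>x\<close>. The levels of the sequence reach \<open>l\<close>, and from then on
    \<open>R n\<close> would lie inside this member.\<close>
  have "x \<notin> C" if "C \<in> \<C>" for C
  proof
    assume "x \<in> C"
    obtain l z where "C = adic_cube c l z" using \<open>C \<in> \<C>\<close> assms(3) small_cubeE[of C] by blast
    with \<open>x \<in> C\<close> have C: "C = adic_cube c l x" using adic_cube_eq by blast
    have "q + int n \<le> fst (f n)" for n
    proof (induction n)
      case (Suc n)
      then show ?case using f(3)[of n] by simp
    qed (simp add: f(2))
    from this[of "nat (l - q)"] have "l \<le> fst (f (nat (l - q)))" by linarith
    moreover have "R n = adic_cube c (fst (f n)) x" for n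
      using xR[of n] adic_cube_eq unfolding R_def by blast
    ultimately have "R (nat (l - q)) \<subseteq> C" using adic_cube_mono[OF c0] C by metis
    then show False using f(1)[of "nat (l - q)"] that by (auto simp: ok_def R_def case_prod_beta)
  qed
  moreover have "R 0 = Q" by (simp add: R_def f(2) Q_eq)
  ultimately show thesis using that xR xW by blast
qed

text \<open>Partition \<open>U\<close> into small cubes. A block neither inside a member of
  \<open>\<C>\<close> nor paid for by the members inside it would contain an uncovered point of the
  intersection, so the exchange applies and covers all of \<open>U\<close> at no extra cost.\<close>

theorem net_content_Inter:
  fixes W :: "nat \<Rightarrow> (real ^ 'n) set"
  assumes "\<And>n. open (W n)" "\<And>n. full_content (W n) V" "open U" "U \<subseteq> V"
  shows "net_content N c g ((\<Inter>n. W n) \<inter> U) = net_content N c g U"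
proof (rule antisym)
  show "net_content N c g ((\<Inter>n. W n) \<inter> U) \<le> net_content N c g U"
    by (rule net_content_ge, rule net_content_le) auto
  show "net_content N c g U \<le> net_content N c g ((\<Inter>n. W n) \<inter> U)"
  proof (rule net_content_ge)
    fix \<C> assume \<C>: "\<C> \<subseteq> small_cubes" "(\<Inter>n. W n) \<inter> U \<subseteq> \<Union>\<C>"
    obtain m where m: "\<And>j x. m \<le> j \<Longrightarrow> adic_cube c j x \<in> small_cubes" using small_level by metis
    obtain \<A> where \<A>: "\<A> \<subseteq> {adic_cube c j x | j x. m \<le> j}" "disjoint \<A>" "\<Union>\<A> = U"
      by (rule adic_partition[OF c2 assms(3)])
    have \<A>_small: "\<A> \<subseteq> small_cubes" using \<A>(1) m by auto
    have "\<exists>\<D>. \<D> \<subseteq> \<C> \<union> \<A> \<and> \<Union>\<A> \<subseteq> \<Union>\<D> \<and> weight price \<D> \<le> weight price \<C>"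
    proof (rule replace_cover[of \<A> \<C> price price])
      show "countable \<A>" using \<A>_small by (rule countable_small)
      show "{} \<notin> \<A>" "{} \<notin> \<C>" using empty_notin_small \<A>_small \<C>(1) by auto
      show "(\<exists>C\<in>\<C>. A \<subseteq> C) \<or> price A \<le> weight price {C \<in> \<C>. C \<subseteq> A}" if A: "A \<in> \<A>" for A
      proof (rule ccontr)
        assume "\<not> ?thesis"
        then have *: "\<not> (\<exists>C\<in>\<C>. A \<subseteq> C)" "weight price {C \<in> \<C>. C \<subseteq> A} < price A" by auto
        have "A \<in> small_cubes" "A \<subseteq> V" using A \<A>_small \<A>(3) assms(4) by auto
        then obtain x where "x \<in> A" "x \<in> (\<Inter>n. W n)" "x \<notin> \<Union>\<C>"
          by (rule full_content_Inter_point[OF assms(1,2) \<C>(1) _ _ *])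
        then show False using \<C>(2) \<A>(3) A by blast
      qed
    qed (use \<A>(2) in auto)
    then obtain \<D> where \<D>: "\<D> \<subseteq> \<C> \<union> \<A>" "\<Union>\<A> \<subseteq> \<Union>\<D>" "weight price \<D> \<le> weight price \<C>"
      by blast
    have "net_content N c g U \<le> weight price \<D>"
      using \<D>(1,2) \<A>(3) \<A>_small \<C>(1) by (intro net_content_le) auto
    then show "net_content N c g U \<le> weight price \<C>" using \<D>(3) by simp
  qed
qed

end

section \<open>Rotation invariance of Lebesgue measure\<close>

lemma adic_cube_translate:
  assumes "0 < c"
  obtains v where "adic_cube c j x = (+) v ` adic_cube c j 0"
proof -
  have nz: "real c powi j \<noteq> 0" using assms by simp
  define v where "v = (\<chi> l. real_of_int \<lfloor>real c powi j * x $ l\<rfloor> / real c powi j)"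
  have fl: "\<lfloor>real c powi j * (y $ l - v $ l)\<rfloor> = \<lfloor>real c powi j * y $ l\<rfloor> - \<lfloor>real c powi j * x $ l\<rfloor>" for y l
  proof -
    have "real c powi j * (y $ l - v $ l) = real c powi j * y $ l - real_of_int \<lfloor>real c powi j * x $ l\<rfloor>"
      using nz by (simp add: v_def right_diff_distrib)
    then show ?thesis by linarith
  qed
  have "y - v \<in> adic_cube c j 0 \<longleftrightarrow> y \<in> adic_cube c j x" for y
    using fl by (simp add: adic_cube_def)
  then have "adic_cube c j x = (\<lambda>y. y - v) -` adic_cube c j 0" by auto
  also have "\<dots> = (+) v ` adic_cube c j 0"
  proof (intro equalityI subsetI)
    fix y assume "y \<in> (\<lambda>y. y - v) -` adic_cube c j 0"
    then show "y \<in> (+) v ` adic_cube c j 0" by (intro image_eqI[of _ _ "y - v"]) auto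
  qed auto
  finally show thesis by (rule that)
qed

text \<open>The mass of a cube depends on its level alone, and a coarse cube splits into the same
  number of fine ones whatever the measure. So both measures are proportional on cubes, which form
  an intersection-stable generator once the empty set is added.\<close>

lemma translation_invariant_eq_lborel:
  fixes M :: "(real ^ 'n) measure"
  assumes sets: "sets M = sets borel"
    and inv: "\<And>a X. X \<in> sets borel \<Longrightarrow> emeasure M ((+) a ` X) = emeasure M X"
    and fin: "emeasure M (adic_cube 2 0 0) \<noteq> \<infinity>"
  shows "M = scale_measure (emeasure M (adic_cube 2 0 0)) lborel"
proof (rule measure_eqI_generator_eq_countable)
  let ?E = "insert {} (adic_cubes 2) :: (real ^ 'n) set set"
  let ?A = "range (adic_cube 2 0) :: (real ^ 'n) set set"
  have level: "emeasure M (adic_cube 2 j x) = emeasure M (adic_cube 2 j 0)" for j and x :: "real ^ 'n"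
    using adic_cube_translate[of 2 j x] inv[OF adic_cube_borel] by (metis pos2)
  \<comment> \<open>Cross-multiplied, so that the number of subcubes cancels without being computed
    and one identity serves levels on both sides of 0.\<close>
  have refine: "emeasure M (adic_cube 2 j 0) * emeasure lborel (adic_cube 2 i 0 :: (real ^ 'n) set) =
      emeasure M (adic_cube 2 i 0) * emeasure lborel (adic_cube 2 j 0 :: (real ^ 'n) set)"
    if ij: "j \<le> i" for i j
  proof -
    define \<D> where "\<D> = adic_cube 2 i ` (adic_cube 2 j 0 :: (real ^ 'n) set)"
    have sub: "\<D> \<subseteq> adic_cubes 2" unfolding \<D>_def using adic_cube_in[of 2] by auto
    then have cnt: "countable \<D>" using countable_subset[OF _ countable_adic_cubes] by blast
    have disj: "disjoint_family_on (\<lambda>X. X) \<D>"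
      unfolding disjoint_family_on_def \<D>_def using adic_cube_eq by blast
    have Un: "(\<Union>X\<in>\<D>. X) = adic_cube 2 j 0"
    proof (intro equalityI subsetI)
      fix y assume "y \<in> (\<Union>X\<in>\<D>. X)"
      then obtain x where x: "x \<in> adic_cube 2 j 0" "y \<in> adic_cube 2 i x" unfolding \<D>_def by blast
      then have "y \<in> adic_cube 2 j x" using adic_cube_mono[OF _ ij, of 2 x] by auto
      then show "y \<in> adic_cube 2 j 0" using adic_cube_eq[OF x(1)] by simp
    next
      fix y :: "real ^ 'n" assume "y \<in> adic_cube 2 j 0"
      then show "y \<in> (\<Union>X\<in>\<D>. X)" unfolding \<D>_def using adic_cube_self by blast
    qed
    have count: "emeasure L (adic_cube 2 j 0) = emeasure L (adic_cube 2 i 0) * emeasure (count_space \<D>) \<D>"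
      if L: "sets L = sets borel" "\<And>x :: real ^ 'n. emeasure L (adic_cube 2 i x) = emeasure L (adic_cube 2 i 0)" for L
    proof -
      have "emeasure L (adic_cube 2 j 0) = (\<integral>\<^sup>+X. emeasure L X \<partial>count_space \<D>)"
        unfolding Un[symmetric]
        using sub adic_cubes_borel[of 2] L(1) by (intro emeasure_UN_countable cnt disj) auto
      also have "\<dots> = (\<integral>\<^sup>+X. emeasure L (adic_cube 2 i 0) \<partial>count_space \<D>)"
        using L(2) by (intro nn_integral_cong) (auto simp: \<D>_def)
      finally show ?thesis by simp
    qed
    have "emeasure lborel (adic_cube 2 i x) = emeasure lborel (adic_cube 2 i 0 :: (real ^ 'n) set)" for x :: "real ^ 'n"
      by (simp add: emeasure_adic_cube)
    then show ?thesis
      using count[OF sets level] count[of lborel] by (simp add: mult_ac)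
  qed
  have unit: "emeasure lborel (adic_cube 2 0 x :: (real ^ 'n) set) = 1" for x
    by (simp add: emeasure_adic_cube)
  show "Int_stable ?E"
  proof (rule Int_stableI)
    fix a b :: "(real ^ 'n) set" assume "a \<in> ?E" "b \<in> ?E"
    then show "a \<inter> b \<in> ?E"
    proof (cases "a \<inter> b = {}")
      case False
      then have "a \<subseteq> b \<or> b \<subseteq> a"
        using adic_cubes_nested[of 2 a b] \<open>a \<in> ?E\<close> \<open>b \<in> ?E\<close> by auto
      then show ?thesis
        using \<open>a \<in> ?E\<close> \<open>b \<in> ?E\<close> by (metis Int_absorb1 Int_absorb2)
    qed simp
  qed
  show "emeasure M X = emeasure (scale_measure (emeasure M (adic_cube 2 0 0)) lborel) X" if "X \<in> ?E" for X
  proof (cases "X = {}")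
    case False
    then obtain j x where X: "X = adic_cube 2 j x" using \<open>X \<in> ?E\<close> by (auto simp: adic_cubes_eq)
    have "emeasure M (adic_cube 2 j 0) = emeasure M (adic_cube 2 0 0) * emeasure lborel (adic_cube 2 j 0 :: (real ^ 'n) set)"
    proof (cases "j \<le> 0")
      case True
      from refine[OF this] show ?thesis unfolding unit mult_1_right .
    next
      case False
      then have "0 \<le> j" by simp
      from refine[OF this] show ?thesis unfolding unit mult_1_right by (rule sym)
    qed
    moreover have "emeasure M X = emeasure M (adic_cube 2 j 0)" unfolding X by (rule level)
    moreover have "emeasure lborel X = emeasure lborel (adic_cube 2 j 0 :: (real ^ 'n) set)"
      by (simp add: X emeasure_adic_cube)
    ultimately show ?thesis by (simp only: emeasure_scale_measure)
  qed simp
  have borel: "sets borel = sigma_sets UNIV ?E"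
  proof
    have "{W :: (real ^ 'n) set. open W} \<subseteq> sigma_sets UNIV ?E"
    proof
      fix W :: "(real ^ 'n) set" assume "W \<in> {W. open W}"
      then have "open W" by simp
      then obtain \<A> where \<A>: "\<A> \<subseteq> {adic_cube 2 j x | j x. 0 \<le> j}" "disjoint \<A>" "\<Union>\<A> = W"
        by (rule adic_partition[OF order_refl])
      then have "\<A> \<subseteq> adic_cubes 2" using adic_cube_in[of 2] by auto
      then have "\<Union>\<A> \<in> sigma_sets UNIV ?E"
        using countable_subset[OF _ countable_adic_cubes] by (intro sigma_sets_UNION) auto
      then show "W \<in> sigma_sets UNIV ?E" using \<A>(3) by simp
    qed
    then show "sets borel \<subseteq> sigma_sets UNIV ?E"
      unfolding borel_def by (simp add: sigma_sets_mono)
    show "sigma_sets UNIV ?E \<subseteq> sets borel"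
      using adic_cubes_borel[of 2] sets.sigma_sets_subset[of ?E borel] by auto
  qed
  show "sets M = sigma_sets UNIV ?E" using sets borel by simp
  show "sets (scale_measure (emeasure M (adic_cube 2 0 0)) lborel) = sigma_sets UNIV ?E"
    using borel by simp
  show "?A \<subseteq> ?E" using adic_cube_in[of 2] by auto
  show "\<Union>?A = UNIV" using adic_cube_self by blast
  show "countable ?A"
    by (rule countable_subset[OF \<open>?A \<subseteq> ?E\<close>]) (simp add: countable_adic_cubes)
  show "emeasure M a \<noteq> \<infinity>" if "a \<in> ?A" for a
  proof -
    obtain x where "a = adic_cube 2 0 x" using \<open>a \<in> ?A\<close> by blast
    then show ?thesis using fin level[of 0 x] by simp
  qed
qed auto

lemma emeasure_lborel_translate:
  fixes X :: "'a::euclidean_space set"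
  assumes "X \<in> sets borel"
  shows "(+) a ` X \<in> sets borel" "emeasure lborel ((+) a ` X) = emeasure lborel X"
proof -
  have eq: "(+) a ` X = (\<lambda>x. - a + x) -` X \<inter> space borel"
  proof (intro equalityI subsetI)
    fix y assume "y \<in> (\<lambda>x. - a + x) -` X \<inter> space borel"
    then show "y \<in> (+) a ` X" by (intro image_eqI[of _ _ "- a + y"]) auto
  qed auto
  show *: "(+) a ` X \<in> sets borel"
    unfolding eq using assms by (intro measurable_sets[of _ borel borel]) auto
  have "emeasure lborel ((+) a ` X) = emeasure (distr lborel borel ((+) a)) ((+) a ` X)"
    by (simp add: lborel_distr_plus)
  also have "\<dots> = emeasure lborel ((+) a -` ((+) a ` X) \<inter> space lborel)"
    using * by (intro emeasure_distr) auto
  also have "(+) a -` ((+) a ` X) \<inter> space lborel = X" by auto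
  finally show "emeasure lborel ((+) a ` X) = emeasure lborel X" .
qed

text \<open>Assigning to a set the volume of its image is a translation invariant measure by
  linearity of \<open>f\<close>, hence a multiple of Lebesgue measure. The unit ball is mapped onto
  itself, so the factor is 1.\<close>

lemma emeasure_orthogonal_image:
  fixes f :: "real ^ 'n \<Rightarrow> real ^ 'n"
  assumes f: "orthogonal_transformation f" and X: "X \<in> sets borel"
  shows "f ` X \<in> sets borel" "emeasure lborel (f ` X) = emeasure lborel X"
proof -
  have lin: "linear f" and bij: "bij f" and nrm: "norm (f v) = norm v" for v
    using f orthogonal_transformation_linear orthogonal_transformation_bij orthogonal_transformation_norm by auto
  have vimage: "f ` Y = inv f -` Y" for Y using bij by (metis bij_imp_bij_inv bij_vimage_eq_inv_image inv_inv_eq)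
  have "linear (inv f)" using orthogonal_transformation_inv[OF f] orthogonal_transformation_linear by blast
  then have cont: "continuous_on UNIV (inv f)" by (rule linear_continuous_on[OF linear_conv_bounded_linear[THEN iffD1]])
  then have meas: "inv f \<in> borel_measurable borel" by (rule borel_measurable_continuous_onI)
  define M where "M = distr lborel borel (inv f)"
  have sets_M: "sets M = sets borel" by (simp add: M_def)
  have M: "emeasure M Y = emeasure lborel (f ` Y)" if "Y \<in> sets borel" for Y
    unfolding M_def vimage using meas that by (subst emeasure_distr) auto
  have img: "f ` Y \<in> sets borel" if "Y \<in> sets borel" for Y
    unfolding vimage using measurable_sets[OF meas that] by simp
  show "f ` X \<in> sets borel" using X by (rule img)
  have fin: "emeasure M (adic_cube 2 0 0) \<noteq> \<infinity>"
  proof -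
    obtain u v :: "real ^ 'n" where uv: "adic_cube 2 0 0 \<subseteq> cbox u v" using adic_cube_box[of 2] by (metis pos2)
    then have "bounded (adic_cube 2 0 0 :: (real ^ 'n) set)" using bounded_cbox bounded_subset by blast
    then have "bounded (f ` adic_cube 2 0 0)"
      using lin linear_conv_bounded_linear bounded_linear_image by blast
    then show ?thesis
      using M[OF adic_cube_borel[of 2 0 0]] emeasure_bounded_finite by (metis infinity_ennreal_def less_irrefl)
  qed
  have inv: "emeasure M ((+) a ` Y) = emeasure M Y" if Y: "Y \<in> sets borel" for a Y
  proof -
    have "f ` ((+) a ` Y) = (+) (f a) ` (f ` Y)" using lin by (simp add: image_image linear_add)
    moreover have "emeasure M ((+) a ` Y) = emeasure lborel (f ` ((+) a ` Y))"
      by (rule M) (rule emeasure_lborel_translate(1)[OF Y])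
    ultimately show ?thesis
      using emeasure_lborel_translate(2)[OF img[OF Y]] M[OF Y] by simp
  qed
  have eq: "M = scale_measure (emeasure M (adic_cube 2 0 0)) lborel"
    by (rule translation_invariant_eq_lborel[OF sets_M inv fin])
  let ?B = "ball 0 1 :: (real ^ 'n) set"
  have "f ` ?B = ?B"
  proof (intro equalityI subsetI)
    fix x assume "x \<in> ?B"
    moreover obtain y where "x = f y" using bij by (meson bij_pointE)
    ultimately show "x \<in> f ` ?B" by (auto simp: nrm)
  qed (auto simp: nrm)
  then have "emeasure lborel ?B = emeasure M ?B" using M[of ?B] by simp
  also have "\<dots> = emeasure M (adic_cube 2 0 0) * emeasure lborel ?B" by (subst eq) simp
  finally have "emeasure lborel ?B = emeasure M (adic_cube 2 0 0) * emeasure lborel ?B" .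
  moreover have "emeasure lborel ?B \<noteq> 0" "emeasure lborel ?B \<noteq> top"
    using content_ball_pos[of 1 "0 :: real ^ 'n"] emeasure_lborel_ball_finite[of "0 :: real ^ 'n" 1]
    by (auto simp: measure_def less_top)
  ultimately have "emeasure M (adic_cube 2 0 0) = 1"
    by (metis ennreal_mult_cancel_left mult.commute mult.right_neutral infinity_ennreal_def)
  then have "emeasure M X = emeasure lborel X" by (subst eq) simp
  then show "emeasure lborel (f ` X) = emeasure lborel X" using M[OF X] by simp
qed

text \<open>Orthonormal bases of \<open>L\<close> and of its orthogonal complement, indexed by
  \<open>S\<close> and by \<open>- S\<close>, together form the image of the standard basis.\<close>

lemma orthogonal_frame:
  fixes L :: "(real ^ 'n) set" and S :: "'n set"
  assumes L: "subspace L" and S: "card S = dim L"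
  obtains f :: "real ^ 'n \<Rightarrow> real ^ 'n" where "orthogonal_transformation f" "\<And>i. i \<in> S \<Longrightarrow> f (axis i 1) \<in> L"
proof -
  let ?L' = "{y \<in> UNIV. \<forall>x \<in> L. orthogonal x y}"
  have sub': "subspace ?L'" by (auto simp: subspace_def orthogonal_clauses)
  have dim: "dim ?L' + dim L = CARD('n)"
    using dim_subspace_orthogonal_to_vectors[OF L subspace_UNIV] by simp
  obtain B where B: "B \<subseteq> L" "pairwise orthogonal B" "\<forall>x\<in>B. norm x = 1" "independent B" "card B = dim L"
    by (rule orthonormal_basis_subspace[OF L]) (blast intro: that)
  obtain B' where B': "B' \<subseteq> ?L'" "pairwise orthogonal B'" "\<forall>x\<in>B'. norm x = 1" "independent B'" "card B' = dim ?L'"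
    by (rule orthonormal_basis_subspace[OF sub']) (blast intro: that)
  have finB: "finite B" "finite B'" using B(4) B'(4) independent_imp_finite by auto
  obtain p where p: "bij_betw p S B"
    using finB(1) B(5) S finite_same_card_bij[of S B] by auto
  have "card (- S) = card B'"
    using B'(5) S dim by (simp add: Compl_eq_Diff_UNIV card_Diff_subset)
  then obtain p' where p': "bij_betw p' (- S) B'"
    using finB(2) finite_same_card_bij[of "- S" B'] by auto
  define q where "q i = (if i \<in> S then p i else p' i)" for i
  have q_S: "q i \<in> B" if "i \<in> S" for i using that p by (auto simp: q_def bij_betw_def)
  have q_S': "q i \<in> B'" if "i \<notin> S" for i using that p' by (auto simp: q_def bij_betw_def)
  have one: "q i \<bullet> q i = 1" for i
    using q_S[of i] q_S'[of i] B(3) B'(3) by (cases "i \<in> S") (auto simp: dot_square_norm)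
  have zero: "q i \<bullet> q j = 0" if "i \<noteq> j" for i j
  proof -
    consider "i \<in> S" "j \<in> S" | "i \<in> S" "j \<notin> S" | "i \<notin> S" "j \<in> S" | "i \<notin> S" "j \<notin> S" by blast
    then have "orthogonal (q i) (q j)"
    proof cases
      case 1
      then have "q i \<noteq> q j" using p that by (auto simp: q_def bij_betw_def inj_on_def)
      then show ?thesis using 1 q_S B(2) by (auto simp: pairwise_def)
    next
      case 2
      then show ?thesis using q_S q_S' B(1) B'(1) by blast
    next
      case 3
      then show ?thesis using q_S q_S' B(1) B'(1) by (subst orthogonal_commute) blast
    next
      case 4
      then have "q i \<noteq> q j" using p' that by (auto simp: q_def bij_betw_def inj_on_def)
      then show ?thesis using 4 q_S' B'(2) by (auto simp: pairwise_def)
    qed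
    then show ?thesis by (simp add: orthogonal_def)
  qed
  define f where "f x = (\<Sum>i\<in>UNIV. x $ i *\<^sub>R q i)" for x
  have lin: "linear f"
    by (rule linearI) (auto simp: f_def scaleR_left_distrib sum.distrib scaleR_sum_right)
  have "f v \<bullet> f w = v \<bullet> w" for v w
  proof -
    have "f v \<bullet> f w = (\<Sum>j\<in>UNIV. \<Sum>i\<in>UNIV. v $ i * (w $ j * (q i \<bullet> q j)))"
      by (simp add: f_def inner_sum_left inner_sum_right sum_distrib_left mult.left_commute)
    also have "\<dots> = (\<Sum>i\<in>UNIV. \<Sum>j\<in>UNIV. v $ i * (w $ j * (q i \<bullet> q j)))"
      by (rule sum.swap)
    also have "\<dots> = (\<Sum>i\<in>UNIV. \<Sum>j\<in>UNIV. if j = i then v $ i * w $ i else 0)"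
      by (intro sum.cong refl) (auto simp: one zero)
    finally show ?thesis by (simp add: inner_vec_def)
  qed
  then have orth: "orthogonal_transformation f" using lin by (simp add: orthogonal_transformation_def)
  have "f (axis i 1) = q i" for i
  proof -
    have "f (axis i 1) = (\<Sum>j\<in>UNIV. if j = i then q i else 0)"
      unfolding f_def by (intro sum.cong refl) (auto simp: axis_def)
    then show ?thesis by simp
  qed
  then show thesis using that[OF orth] q_S B(1) by auto
qed

section \<open>Plates around an affine subspace\<close>

lemma norm_le_card_cart:
  fixes x :: "real ^ 'n"
  assumes "\<And>i. \<bar>x $ i\<bar> \<le> B"
  shows "norm x \<le> real CARD('n) * B"
proof -
  have "norm x \<le> (\<Sum>i\<in>UNIV. \<bar>x $ i\<bar>)" by (rule norm_le_l1_cart)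
  also have "\<dots> \<le> real CARD('n) * B" using sum_bounded_above[of UNIV "\<lambda>i. \<bar>x $ i\<bar>" B] assms by simp
  finally show ?thesis .
qed

text \<open>A plate is a rotated box centred at a point of \<open>P\<close>, long in the directions of \<open>P\<close> and thin in
  the orthogonal ones.\<close>

lemma plate_exists:
  fixes P :: "(real ^ 'n) set"
  assumes P: "affine P" "aff_dim P = int k" "y \<in> P"
    and R: "0 < R" and t: "0 < t" "t \<le> R / real CARD('n)"
  obtains A where "A \<in> sets borel" "A \<subseteq> cball y R"
    "\<forall>z\<in>A. \<exists>p\<in>P. norm (z - p) \<le> real CARD('n) * t"
    "emeasure lborel A = ennreal ((2 * R / real CARD('n)) ^ k * (2 * t) ^ (CARD('n) - k))"
    "\<forall>x \<sigma>. 0 < \<sigma> \<longrightarrow> emeasure lborel (A \<inter> cball x \<sigma>) \<le> ennreal ((2 * \<sigma>) ^ k * (2 * min t \<sigma>) ^ (CARD('n) - k))"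
proof -
  let ?d = "CARD('n)"
  define L where "L = (\<lambda>p. p - y) ` P"
  have L: "subspace L" unfolding L_def using P affine_diffs_subspace_subtract by blast
  have dim: "dim L = k" unfolding L_def using P aff_dim_eq_dim_subtract[of y P] by (simp add: hull_inc)
  have "k \<le> ?d" using dim dim_subset_UNIV_cart[of L] by simp
  then obtain S :: "'n set" where S: "card S = k"
    using obtain_subset_with_card_n[of k "UNIV :: 'n set"] by auto
  obtain f :: "real ^ 'n \<Rightarrow> real ^ 'n" where f: "orthogonal_transformation f" "\<And>i. i \<in> S \<Longrightarrow> f (axis i 1) \<in> L"
    using orthogonal_frame[OF L, of S] S dim by metis
  have lin: "linear f" and nrm: "\<And>v. norm (f v) = norm v" and bij: "bij f"
    using f(1) orthogonal_transformation_linear orthogonal_transformation_bij orthogonal_transformation_norm by auto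
  \<comment> \<open>Half-widths of the box. The divisor compensates for bounding the norm by
    CARD('n) times the largest coordinate, so that the plate stays in the ball of radius
    \<open>R\<close>.\<close>
  define w :: "real ^ 'n" where "w = (\<chi> i. if i \<in> S then R / ?d else t)"
  have w_pos: "0 < w $ i" for i using R t by (simp add: w_def)
  have w_le: "w $ i \<le> R / ?d" for i using t by (simp add: w_def)
  define A where "A = (+) y ` f ` cbox (- w) w"
  have box: "\<bar>u $ i\<bar> \<le> w $ i" if "u \<in> cbox (- w) w" for u i
    using that by (auto simp: mem_box_cart abs_le_iff minus_le_iff)
  have meas: "(+) y ` f ` X \<in> sets borel" "emeasure lborel ((+) y ` f ` X) = emeasure lborel X"
    if "X \<in> sets borel" for X
  proof -
    note b = emeasure_orthogonal_image[OF f(1) that]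
    show "(+) y ` f ` X \<in> sets borel" by (rule emeasure_lborel_translate(1)[OF b(1)])
    show "emeasure lborel ((+) y ` f ` X) = emeasure lborel X"
      by (rule trans[OF emeasure_lborel_translate(2)[OF b(1)] b(2)])
  qed
  have split: "(\<Prod>i\<in>UNIV. if i \<in> S then p else q) = p ^ k * q ^ (?d - k)" for p q :: real
  proof -
    have "(\<Prod>i\<in>UNIV. if i \<in> S then p else q) = (\<Prod>i\<in>S. p) * (\<Prod>i\<in>- S. q)"
      by (simp add: prod.If_cases Int_commute)
    also have "\<dots> = p ^ k * q ^ (?d - k)"
      using S by (simp add: Compl_eq_Diff_UNIV card_Diff_subset)
    finally show ?thesis .
  qed
  show thesis
  proof (rule that)
    show "A \<in> sets borel" unfolding A_def by (rule meas) simp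
    show "A \<subseteq> cball y R"
    proof
      fix z assume "z \<in> A"
      then obtain u where u: "u \<in> cbox (- w) w" "z = y + f u" unfolding A_def by blast
      have "norm u \<le> real ?d * (R / ?d)"
        by (rule norm_le_card_cart) (use box[OF u(1)] w_le order_trans in blast)
      then show "z \<in> cball y R" by (simp add: u(2) dist_norm nrm)
    qed
    show "\<forall>z\<in>A. \<exists>p\<in>P. norm (z - p) \<le> real ?d * t"
    proof
      fix z assume "z \<in> A"
      then obtain u where u: "u \<in> cbox (- w) w" "z = y + f u" unfolding A_def by blast
      \<comment> \<open>\<open>v\<close> keeps the coordinates of \<open>u\<close> along
        \<open>P\<close>; the remaining ones, each at most \<open>t\<close>, bound the distance to
        \<open>P\<close>.\<close>
      define v where "v = (\<Sum>i\<in>S. u $ i *\<^sub>R axis i (1::real))"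
      have v: "v $ i = (if i \<in> S then u $ i else 0)" for i
        by (simp add: v_def axis_def if_distrib[of "\<lambda>x. _ * x"] cong: if_cong)
      have "f v = (\<Sum>i\<in>S. u $ i *\<^sub>R f (axis i 1))"
        using lin by (simp add: v_def linear_sum linear_cmul)
      also have "\<dots> \<in> L" using L f(2) by (intro subspace_sum subspace_scale)
      finally obtain p where p: "p \<in> P" "f v = p - y" unfolding L_def by blast
      have "norm (z - p) = norm (u - v)"
        using lin nrm[of "u - v"] by (simp add: u(2) p(2) linear_diff algebra_simps)
      also have "\<dots> \<le> real ?d * t"
      proof (rule norm_le_card_cart)
        show "\<bar>(u - v) $ i\<bar> \<le> t" for i
          using box[OF u(1), of i] t by (auto simp: v w_def split: if_splits)
      qed
      finally show "\<exists>p\<in>P. norm (z - p) \<le> real ?d * t" using p(1) by blast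
    qed
    have "- w \<in> cbox (- w) w"
      using w_pos less_imp_le by (auto simp: mem_box_cart intro: order_trans[of _ 0])
    then have ne: "cbox (- w) w \<noteq> {}" by blast
    have "measure lborel (cbox (- w) w) = (\<Prod>i\<in>UNIV. if i \<in> S then 2 * R / ?d else 2 * t)"
      unfolding content_cbox_cart[OF ne] by (intro prod.cong) (auto simp: w_def)
    then have "emeasure lborel (cbox (- w) w) = ennreal ((2 * R / ?d) ^ k * (2 * t) ^ (?d - k))"
      unfolding split using emeasure_lborel_cbox_finite[of "- w" w]
      by (subst emeasure_eq_ennreal_measure) auto
    then show "emeasure lborel A = ennreal ((2 * R / ?d) ^ k * (2 * t) ^ (?d - k))"
      unfolding A_def by (subst meas(2)) auto
    show "\<forall>x \<sigma>. 0 < \<sigma> \<longrightarrow> emeasure lborel (A \<inter> cball x \<sigma>) \<le> ennreal ((2 * \<sigma>) ^ k * (2 * min t \<sigma>) ^ (?d - k))"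
    proof (intro allI impI)
      fix x \<sigma> assume \<sigma>: "0 < (\<sigma>::real)"
      obtain v where v: "f v = x - y" using bij by (metis bij_pointE)
      \<comment> \<open>In rotated coordinates the ball about \<open>x\<close> lies in the cube of
        half-side \<sigma> about \<open>v\<close>. Intersected with the plate, this gives sides at
        most 2 \<sigma> along \<open>P\<close> and twice the smaller of \<open>t\<close> and
        \<sigma> across it.\<close>
      define a b :: "real ^ 'n" where "a = (\<chi> i. max (- w $ i) (v $ i - \<sigma>))" and "b = (\<chi> i. min (w $ i) (v $ i + \<sigma>))"
      have "A \<inter> cball x \<sigma> \<subseteq> (+) y ` f ` cbox a b"
      proof
        fix z assume z: "z \<in> A \<inter> cball x \<sigma>"
        then obtain u where u: "u \<in> cbox (- w) w" "z = y + f u" unfolding A_def by blast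
        have "x - z = f (v - u)" using lin v by (simp add: u(2) linear_diff algebra_simps)
        then have "norm (v - u) \<le> \<sigma>" using z nrm by (simp add: dist_norm)
        then have "\<bar>(v - u) $ i\<bar> \<le> \<sigma>" for i using component_le_norm_cart order_trans by blast
        then have "\<bar>v $ i - u $ i\<bar> \<le> \<sigma>" for i by simp
        then have "u \<in> cbox a b"
          using u(1) by (auto simp: mem_box_cart a_def b_def abs_le_iff algebra_simps)
        then show "z \<in> (+) y ` f ` cbox a b" using u(2) by blast
      qed
      then have "emeasure lborel (A \<inter> cball x \<sigma>) \<le> emeasure lborel ((+) y ` f ` cbox a b)"
        by (intro emeasure_mono) (simp_all add: meas(1))
      also have "\<dots> = emeasure lborel (cbox a b)" by (rule meas(2)) simp
      also have "\<dots> = ennreal (measure lborel (cbox a b))"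
        using emeasure_lborel_cbox_finite[of a b] by (subst emeasure_eq_ennreal_measure) auto
      also have "measure lborel (cbox a b) \<le> (\<Prod>i\<in>UNIV. if i \<in> S then 2 * \<sigma> else 2 * min t \<sigma>)"
      proof (cases "cbox a b = {}")
        case True
        have "0 \<le> (\<Prod>i\<in>UNIV. if i \<in> S then 2 * \<sigma> else 2 * min t \<sigma>)"
          using \<sigma> t by (intro prod_nonneg) auto
        then show ?thesis using True by simp
      next
        case False
        then have le: "a $ i \<le> b $ i" for i by (simp add: interval_ne_empty_cart)
        show ?thesis
          unfolding content_cbox_cart[OF False]
        proof (rule prod_mono)
          fix i :: 'n
          show "0 \<le> b $ i - a $ i \<and> b $ i - a $ i \<le> (if i \<in> S then 2 * \<sigma> else 2 * min t \<sigma>)"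
            using le[of i] by (auto simp: a_def b_def w_def)
        qed
      qed
      finally show "emeasure lborel (A \<inter> cball x \<sigma>) \<le> ennreal ((2 * \<sigma>) ^ k * (2 * min t \<sigma>) ^ (?d - k))"
        unfolding split by (simp add: ennreal_leI)
    qed
  qed
qed

section \<open>Volumes of balls, double sums, and gauges at small scales\<close>

lemma emeasure_cball_power:
  obtains \<omega> where "0 < \<omega>" "\<And>(y :: real ^ 'n) r. 0 \<le> r \<Longrightarrow> emeasure lborel (cball y r) = ennreal (\<omega> * r ^ CARD('n))"
proof -
  define \<omega> where "\<omega> = measure lborel (ball (0 :: real ^ 'n) 1)"
  show thesis
  proof (rule that)
    show "0 < \<omega>" unfolding \<omega>_def by (rule content_ball_pos) simp
    show "emeasure lborel (cball y r) = ennreal (\<omega> * r ^ CARD('n))" if "0 \<le> r" for y :: "real ^ 'n" and r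
    proof -
      have "emeasure lborel (cball y r) = ennreal (measure lborel (cball y r))"
        using emeasure_lborel_cball_finite[of y r] by (subst emeasure_eq_ennreal_measure) auto
      then show ?thesis
        using content_ball_conv_unit_ball[OF that, of y] by (simp add: content_cball_conv_ball \<omega>_def mult.commute)
    qed
  qed
qed

lemma weight_cmult: "weight (\<lambda>x. c * f x) A = c * weight f A"
  unfolding weight_eq by (rule nn_integral_cmult) simp

lemma weight_indicator: "weight f A = (\<integral>\<^sup>+x. f x * indicator A x \<partial>count_space UNIV)"
  unfolding weight_eq by (simp add: nn_integral_count_space_indicator)

lemma weight_swap: "weight (\<lambda>x. weight (\<lambda>y. f x y) B) A = weight (\<lambda>y. weight (\<lambda>x. f x y) A) B"
proof -
  let ?F = "\<lambda>(x, y). f x y * (indicator A x * indicator B y)"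
  have "weight (\<lambda>x. weight (\<lambda>y. f x y) B) A = (\<integral>\<^sup>+x. \<integral>\<^sup>+y. ?F (x, y) \<partial>count_space UNIV \<partial>count_space UNIV)"
    unfolding weight_indicator
    by (intro nn_integral_cong, subst nn_integral_multc[symmetric]) (simp_all add: mult_ac)
  also have "\<dots> = (\<integral>\<^sup>+y. \<integral>\<^sup>+x. ?F (x, y) \<partial>count_space UNIV \<partial>count_space UNIV)"
    unfolding nn_integral_fst_count_space nn_integral_snd_count_space ..
  also have "\<dots> = weight (\<lambda>y. weight (\<lambda>x. f x y) A) B"
    unfolding weight_indicator
    by (intro nn_integral_cong, subst nn_integral_multc[symmetric]) (simp_all add: mult_ac)
  finally show ?thesis .
qed

lemma distN_less_iff:
  assumes "is_norm N" "P \<noteq> {}"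
  shows "distN N x P < r \<longleftrightarrow> (\<exists>p\<in>P. N (x - p) < r)"
proof -
  have "bdd_below ((\<lambda>p. N (x - p)) ` P)"
    using assms(1) by (intro bdd_belowI[of _ 0]) (auto simp: is_norm_def)
  then show ?thesis unfolding distN_def by (rule cINF_less_iff[OF assms(2)])
qed

lemma gauge_small:
  assumes "g \<in> gauges e" "0 < \<zeta>"
  obtains \<delta> where "0 < \<delta>" "\<And>t. 0 \<le> t \<Longrightarrow> t < \<delta> \<Longrightarrow> g t < \<zeta>"
proof -
  obtain \<epsilon> where \<epsilon>: "0 < \<epsilon>" "continuous_on {0..\<epsilon>} g" "g 0 = 0"
    using assms(1) unfolding gauges_def by blast
  have "0 \<in> {0..\<epsilon>}" using \<epsilon>(1) by simp
  then obtain d where d: "0 < d" "\<And>t. t \<in> {0..\<epsilon>} \<Longrightarrow> dist t 0 < d \<Longrightarrow> dist (g t) (g 0) < \<zeta>"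
    using \<epsilon>(2) assms(2) unfolding continuous_on_iff by metis
  show thesis
  proof (rule that)
    show "0 < min d \<epsilon>" using d(1) \<epsilon>(1) by simp
    show "g t < \<zeta>" if "0 \<le> t" "t < min d \<epsilon>" for t
      using d(2)[of t] that \<epsilon>(3) by (simp add: dist_real_def)
  qed
qed

text \<open>If the ball is larger than \<open>\<sigma>\<close> then it meets the enlarged ball in a whole ball of radius \<open>\<sigma>\<close>;
  otherwise it is contained in it.\<close>

lemma spread_bound:
  fixes x y :: "real ^ 'n"
  assumes A: "A \<subseteq> cball y R" "0 \<le> R" and mass: "w * emeasure lborel A = emeasure lborel (cball y R)"
    and Q: "Q \<subseteq> cball x \<sigma>" "0 < \<sigma>" and borel: "A \<in> sets borel" "Q \<in> sets borel"
    and Y: "w * emeasure lborel (A \<inter> cball x \<sigma>) \<le> Y" "emeasure lborel (cball (0 :: real ^ 'n) \<sigma>) \<le> Y"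
  shows "w * emeasure lborel (A \<inter> Q) * emeasure lborel (cball (0 :: real ^ 'n) \<sigma>)
     \<le> Y * emeasure lborel (cball y R \<inter> cball x (3 * \<sigma>))"
proof (cases "A \<inter> Q = {}")
  case False
  then obtain z where z: "z \<in> A" "z \<in> Q" by blast
  then have zy: "dist y z \<le> R" and zx: "dist x z \<le> \<sigma>" using A Q by (auto simp: subset_eq)
  show ?thesis
  proof (cases "R \<le> \<sigma>")
    \<comment> \<open>The whole ball lies in the enlarged one; the total mass of the plate equals
      the volume of the ball, and the second bound on \<open>Y\<close> suffices.\<close>
    case True
    have "cball y R \<subseteq> cball x (3 * \<sigma>)"
    proof
      fix u assume "u \<in> cball y R"
      then have "dist x u \<le> dist x z + dist y z + R"
        using dist_triangle[of x u z] dist_triangle[of z u y] by (simp add: dist_commute)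
      then show "u \<in> cball x (3 * \<sigma>)" using zx zy True by simp
    qed
    then have eq: "cball y R \<inter> cball x (3 * \<sigma>) = cball y R" by blast
    have "w * emeasure lborel (A \<inter> Q) \<le> w * emeasure lborel A"
      using borel by (intro mult_left_mono emeasure_mono) auto
    then show ?thesis unfolding eq mass using Y(2) by (subst mult.commute) (intro mult_mono, auto)
  next
    case False
    \<comment> \<open>Moving \<open>z\<close> towards the centre \<open>y\<close> by at most
      \<sigma> keeps the ball of radius \<sigma> about \<open>z'\<close> inside the original ball
      and within distance 3 \<sigma> of \<open>x\<close>.\<close>
    define z' where "z' = z + (\<sigma> / R) *\<^sub>R (y - z)"
    have R: "0 < R" "\<sigma> < R" using False Q(2) by auto
    have "dist z' z = \<sigma> / R * dist y z" using Q R by (simp add: z'_def dist_norm)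
    also have "\<dots> \<le> \<sigma> / R * R" using zy Q R by (intro mult_left_mono) auto
    finally have z'z: "dist z' z \<le> \<sigma>" using R by simp
    have "z' - y = (1 - \<sigma> / R) *\<^sub>R (z - y)" by (simp add: z'_def algebra_simps)
    then have "dist z' y = \<bar>1 - \<sigma> / R\<bar> * dist y z" by (simp add: dist_norm norm_minus_commute)
    also have "\<dots> \<le> (1 - \<sigma> / R) * R" using zy Q R by (subst abs_of_nonneg) (auto intro!: mult_left_mono)
    also have "\<dots> = R - \<sigma>" using R by (simp add: field_simps)
    finally have z'y: "dist z' y \<le> R - \<sigma>" .
    have "cball z' \<sigma> \<subseteq> cball y R \<inter> cball x (3 * \<sigma>)"
    proof
      fix u assume "u \<in> cball z' \<sigma>"
      then have u: "dist z' u \<le> \<sigma>" by simp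
      have "dist y u \<le> dist z' y + dist z' u" by (metis dist_commute dist_triangle)
      moreover have "dist x u \<le> dist x z + (dist z' z + dist z' u)"
        using dist_triangle[of x u z] dist_triangle[of z u z'] by (simp add: dist_commute)
      ultimately show "u \<in> cball y R \<inter> cball x (3 * \<sigma>)" using u z'z z'y zx by simp
    qed
    then have "emeasure lborel (cball z' \<sigma>) \<le> emeasure lborel (cball y R \<inter> cball x (3 * \<sigma>))"
      by (intro emeasure_mono) auto
    moreover have "emeasure lborel (cball z' \<sigma>) = emeasure lborel (cball (0 :: real ^ 'n) \<sigma>)"
      using Q(2) by (metis emeasure_cball_power less_imp_le)
    moreover have "w * emeasure lborel (A \<inter> Q) \<le> Y"
    proof -
      have "w * emeasure lborel (A \<inter> Q) \<le> w * emeasure lborel (A \<inter> cball x \<sigma>)"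
        using borel Q(1) by (intro mult_left_mono emeasure_mono) auto
      then show ?thesis using Y(1) by (rule order_trans)
    qed
    ultimately show ?thesis by (intro mult_mono) auto
  qed
qed simp

text \<open>Compare the tube radius \<open>r\<close> with the cube diameter \<beta> \<sigma>. If
  \<open>r\<close> is the smaller, monotonicity of \<open>f\<close> suffices; otherwise the factor
  (\<sigma> / (\<tau> r))^e offsets f(r), because f(t) / t^e is nonincreasing. The two summands of
  the constant belong to the two cases.\<close>

lemma plate_gauge_bound:
  fixes \<tau> \<beta> r \<sigma> :: real
  assumes f: "f \<in> gauges e" and r: "0 < r" "r < gauge_eps e f" and \<sigma>: "0 < \<sigma>" "\<beta> * \<sigma> < gauge_eps e f"
    and pos: "0 < \<tau>" "0 < \<beta>"
  shows "f r * (min (\<tau> * r) \<sigma> / (\<tau> * r)) ^ e \<le> (1 + (1 / (\<beta> * \<tau>)) ^ e) * f (\<beta> * \<sigma>)"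
proof -
  let ?s = "\<beta> * \<sigma>"
  have fs: "0 < f ?s" using gauge_pos[OF f \<sigma>(2)] \<sigma> pos by simp
  have fr: "0 < f r" using gauge_pos[OF f r(2)] r by simp
  have c: "0 \<le> (1 / (\<beta> * \<tau>)) ^ e" using pos by simp
  show ?thesis
  proof (cases "r \<le> ?s")
    case True
    have "(min (\<tau> * r) \<sigma> / (\<tau> * r)) ^ e \<le> 1"
      using pos r \<sigma> by (intro power_le_one) auto
    then have "f r * (min (\<tau> * r) \<sigma> / (\<tau> * r)) ^ e \<le> f r"
      using fr by (simp add: mult_left_le)
    also have "\<dots> \<le> f ?s" using gauge_mono[OF f \<sigma>(2)] r True by simp
    also have "\<dots> \<le> (1 + (1 / (\<beta> * \<tau>)) ^ e) * f ?s" using c fs by simp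
    finally show ?thesis .
  next
    case False
    have "f r / r ^ e \<le> f ?s / ?s ^ e" using gauge_ratio[OF f r(2)] False \<sigma> pos by simp
    then have "f r \<le> f ?s / ?s ^ e * r ^ e" using r by (simp add: pos_divide_le_eq)
    moreover have "(min (\<tau> * r) \<sigma> / (\<tau> * r)) ^ e \<le> (\<sigma> / (\<tau> * r)) ^ e"
      using pos r \<sigma> by (intro power_mono divide_right_mono) auto
    ultimately have "f r * (min (\<tau> * r) \<sigma> / (\<tau> * r)) ^ e \<le> (f ?s / ?s ^ e * r ^ e) * (\<sigma> / (\<tau> * r)) ^ e"
      using fs \<sigma> pos r by (intro mult_mono) auto
    also have "\<dots> = (1 / (\<beta> * \<tau>)) ^ e * f ?s"
      using \<sigma> pos r by (simp add: power_mult_distrib power_divide)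
    also have "\<dots> \<le> (1 + (1 / (\<beta> * \<tau>)) ^ e) * f ?s" using fs by simp
    finally show ?thesis .
  qed
qed

text \<open>\<open>w\<close> is the constant density that gives the plate the volume of the ball.
  The volume of the ball of radius \<sigma> stays on the left and a piece of the original ball on
  the right: in this form the estimate can be summed over disjoint balls before cancelling.\<close>

lemma tube_plates:
  fixes N :: "real ^ 'n \<Rightarrow> real"
  assumes N: "is_norm N" and k: "k < CARD('n)" and e_def: "e = CARD('n) - k"
    and f: "f \<in> gauges e" and \<beta>: "0 < \<beta>"
  obtains a C s0 where "0 < a" "\<forall>x. a * norm x \<le> N x" "0 < C" "0 < s0" "s0 < gauge_eps e f"
    "\<forall>P y r. affine P \<and> aff_dim P = int k \<and> y \<in> P \<and> 0 < r \<and> r \<le> s0 \<longrightarrow>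
      (\<exists>A w. A \<in> sets borel \<and> A \<subseteq> cball y (f r powr (1 / real e) / a) \<and> A \<subseteq> {x. distN N x P < r} \<and>
        w * emeasure lborel A = emeasure lborel (cball y (f r powr (1 / real e) / a)) \<and>
        (\<forall>Q x \<sigma>. Q \<in> sets borel \<and> Q \<subseteq> cball x \<sigma> \<and> 0 < \<sigma> \<and> \<beta> * \<sigma> \<le> s0 \<longrightarrow>
          w * emeasure lborel (A \<inter> Q) * emeasure lborel (cball (0 :: real ^ 'n) \<sigma>) \<le>
            ennreal (C * (\<beta> * \<sigma>) ^ k * f (\<beta> * \<sigma>)) *
            emeasure lborel (cball y (f r powr (1 / real e) / a) \<inter> cball x (3 * \<sigma>))))"
proof -
  let ?d = "CARD('n)"
  have e: "0 < e" "k + e = ?d" using k by (auto simp: e_def)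
  have d: "0 < real ?d" by simp
  obtain a where a: "0 < a" "\<And>x. a * norm x \<le> N x" using norm_le_is_norm[OF N] by metis
  obtain b where b: "0 < b" "\<And>x. N x \<le> b * norm x" using is_norm_le_norm[OF N] by metis
  obtain \<omega> where \<omega>: "0 < \<omega>" "\<And>(y :: real ^ 'n) r. 0 \<le> r \<Longrightarrow> emeasure lborel (cball y r) = ennreal (\<omega> * r ^ ?d)"
    using emeasure_cball_power by metis
  define s0 where "s0 = gauge_eps e f / 2"
  have s0: "0 < s0" "s0 < gauge_eps e f" using gauge_eps_pos[OF f] by (auto simp: s0_def)
  \<comment> \<open>Since f(t) / t^e is nonincreasing, f(t) stays above \<eta> t^e up to
    \<open>s0\<close>. This bounds the ball radii from below and volumes by the gauge.\<close>
  define \<eta> where "\<eta> = f s0 / s0 ^ e"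
  have \<eta>: "0 < \<eta>" using gauge_pos[OF f s0(2,1)] s0 by (simp add: \<eta>_def)
  have f_pos: "0 < f t" and f_ge: "\<eta> * t ^ e \<le> f t" if "0 < t" "t \<le> s0" for t
  proof -
    show "0 < f t" using gauge_pos[OF f _ that(1)] that s0 by simp
    have "\<eta> \<le> f t / t ^ e" unfolding \<eta>_def using gauge_ratio[OF f s0(2) that] .
    then show "\<eta> * t ^ e \<le> f t" using that by (simp add: pos_le_divide_eq)
  qed
  define \<rho> where "\<rho> = \<eta> powr (1 / real e)"
  have root: "(t powr (1 / real e)) ^ e = t" if "0 < t" for t
    using that e by (simp add: powr_realpow[symmetric] powr_powr)
  have \<rho>: "0 < \<rho>" "\<rho> ^ e = \<eta>" using \<eta> root by (auto simp: \<rho>_def)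
  \<comment> \<open>The first bound keeps the plate within \<open>N\<close>-distance r / 2 of
    \<open>P\<close>. The second gives \<tau> r \<le> R / CARD('n), as \<open>plate_exists\<close>
    requires, because a R is at least \<rho> r.\<close>
  define \<tau> where "\<tau> = min (1 / (2 * b * ?d)) (\<rho> / (a * ?d))"
  have \<tau>: "0 < \<tau>" "\<tau> * (2 * b * ?d) \<le> 1" "\<tau> * (a * ?d) \<le> \<rho>"
  proof -
    show "0 < \<tau>" using a b \<rho> by (simp add: \<tau>_def)
    have "\<tau> \<le> 1 / (2 * b * ?d)" "\<tau> \<le> \<rho> / (a * ?d)" by (auto simp: \<tau>_def)
    then show "\<tau> * (2 * b * ?d) \<le> 1" "\<tau> * (a * ?d) \<le> \<rho>" using a b by (simp_all add: pos_le_divide_eq)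
  qed
  \<comment> \<open>\<open>C1\<close> controls the mass of the plate in a ball of radius \<sigma>,
    \<open>C2\<close> the volume of that ball; their sum yields the common bound \<open>Y\<close> of
    \<open>spread_bound\<close>.\<close>
  define C1 where "C1 = \<omega> * real ?d ^ k / (a ^ e * \<beta> ^ k) * (1 + (1 / (\<beta> * \<tau>)) ^ e)"
  define C2 where "C2 = \<omega> / (\<beta> ^ ?d * \<eta>)"
  have C1: "0 < C1" using \<omega> a \<beta> \<tau> by (auto simp: C1_def intro!: mult_pos_pos divide_pos_pos add_pos_nonneg)
  have C2: "0 < C2" using \<omega> \<beta> \<eta> by (simp add: C2_def)
  have main: "\<exists>A w. A \<in> sets borel \<and> A \<subseteq> cball y (f r powr (1 / real e) / a) \<and> A \<subseteq> {x. distN N x P < r} \<and>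
        w * emeasure lborel A = emeasure lborel (cball y (f r powr (1 / real e) / a)) \<and>
        (\<forall>Q x \<sigma>. Q \<in> sets borel \<and> Q \<subseteq> cball x \<sigma> \<and> 0 < \<sigma> \<and> \<beta> * \<sigma> \<le> s0 \<longrightarrow>
          w * emeasure lborel (A \<inter> Q) * emeasure lborel (cball (0 :: real ^ 'n) \<sigma>) \<le>
            ennreal ((C1 + C2) * (\<beta> * \<sigma>) ^ k * f (\<beta> * \<sigma>)) *
            emeasure lborel (cball y (f r powr (1 / real e) / a) \<inter> cball x (3 * \<sigma>)))"
    if P: "affine P" "aff_dim P = int k" "y \<in> P" and r: "0 < r" "r \<le> s0" for P y r
  proof -
    define R where "R = f r powr (1 / real e) / a"
    have R: "0 < R" using a f_pos[OF r] by (simp add: R_def)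
    have Re: "R ^ e = f r / a ^ e" using root[OF f_pos[OF r]] by (simp add: R_def power_divide)
    have "(\<rho> * r) ^ e = \<eta> * r ^ e" by (simp only: power_mult_distrib \<rho>(2))
    also have "\<dots> \<le> f r" by (rule f_ge[OF r])
    also have "f r = (a * R) ^ e" unfolding power_mult_distrib Re using a(1) by simp
    finally have "\<rho> * r \<le> a * R"
      using a(1) R e(1) by (metis Suc_pred less_imp_le mult_pos_pos power_le_imp_le_base)
    moreover have "\<tau> * (a * ?d) * r \<le> \<rho> * r" using \<tau> r by (intro mult_right_mono) auto
    ultimately have "a * (\<tau> * r * ?d) \<le> a * R" by (simp add: mult_ac)
    then have "\<tau> * r * ?d \<le> R" using a by simp
    then have tR: "\<tau> * r \<le> R / ?d" by (simp add: pos_le_divide_eq)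
    have t: "0 < \<tau> * r" using \<tau> r by simp
    obtain A where A: "A \<in> sets borel" "A \<subseteq> cball y R"
      "\<forall>z\<in>A. \<exists>p\<in>P. norm (z - p) \<le> real ?d * (\<tau> * r)"
      "emeasure lborel A = ennreal ((2 * R / real ?d) ^ k * (2 * (\<tau> * r)) ^ (?d - k))"
      "\<forall>x \<sigma>. 0 < \<sigma> \<longrightarrow> emeasure lborel (A \<inter> cball x \<sigma>) \<le> ennreal ((2 * \<sigma>) ^ k * (2 * min (\<tau> * r) \<sigma>) ^ (?d - k))"
      by (rule plate_exists[OF P R t tR])
    define mA where "mA = (2 * R / ?d) ^ k * (2 * (\<tau> * r)) ^ e"
    have mA: "0 < mA" "emeasure lborel A = ennreal mA"
      using R t A(4) by (auto simp: mA_def e_def)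
    define w where "w = \<omega> * R ^ ?d / mA"
    have w: "0 < w" using \<omega> R mA by (simp add: w_def)
    have mass: "ennreal w * emeasure lborel A = emeasure lborel (cball y R)"
      using mA w \<omega>(2)[of R y] R by (simp add: ennreal_mult[symmetric] w_def)
    have near: "A \<subseteq> {x. distN N x P < r}"
    proof
      fix z assume "z \<in> A"
      then obtain p where p: "p \<in> P" "norm (z - p) \<le> real ?d * (\<tau> * r)" using A(3) by blast
      have "N (z - p) \<le> b * norm (z - p)" by (rule b(2))
      also have "\<dots> \<le> b * (real ?d * (\<tau> * r))" using p b by (intro mult_left_mono) auto
      also have "\<dots> = (\<tau> * (2 * b * ?d)) * r / 2" by (simp add: field_simps)
      also have "\<dots> \<le> 1 * r / 2" using \<tau>(2) r by (intro divide_right_mono mult_right_mono) auto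
      also have "\<dots> < r" using r by simp
      finally show "z \<in> {x. distN N x P < r}"
        using p(1) distN_less_iff[OF N, of P] by auto
    qed
    have bound: "ennreal w * emeasure lborel (A \<inter> Q) * emeasure lborel (cball (0 :: real ^ 'n) \<sigma>) \<le>
            ennreal ((C1 + C2) * (\<beta> * \<sigma>) ^ k * f (\<beta> * \<sigma>)) * emeasure lborel (cball y R \<inter> cball x (3 * \<sigma>))"
      if Q: "Q \<in> sets borel" "Q \<subseteq> cball x \<sigma>" and \<sigma>: "0 < \<sigma>" "\<beta> * \<sigma> \<le> s0" for Q x \<sigma>
    proof (rule spread_bound[OF A(2) _ mass Q(2) \<sigma>(1) A(1) Q(1)])
      let ?s = "\<beta> * \<sigma>"
      have s: "0 < ?s" using \<sigma> \<beta> by simp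
      have fs: "0 < f ?s" by (rule f_pos[OF s \<sigma>(2)])
      have Y1: "0 \<le> C1 * ?s ^ k * f ?s" and Y2: "0 \<le> C2 * ?s ^ k * f ?s"
        using C1 C2 s fs by auto
      show "0 \<le> R" using R by simp
      have "ennreal w * emeasure lborel (A \<inter> cball x \<sigma>) \<le> ennreal w * ennreal ((2 * \<sigma>) ^ k * (2 * min (\<tau> * r) \<sigma>) ^ e)"
        using A(5) \<sigma> by (intro mult_left_mono) (auto simp: e_def)
      also have "\<dots> = ennreal (w * ((2 * \<sigma>) ^ k * (2 * min (\<tau> * r) \<sigma>) ^ e))"
        using w by (simp add: ennreal_mult')
      \<comment> \<open>R^d equals R^k f(r) / a^e, and R^k cancels against the length of the plate,
        leaving a bound free of \<open>R\<close>.\<close>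
      also have "w * ((2 * \<sigma>) ^ k * (2 * min (\<tau> * r) \<sigma>) ^ e) =
          \<omega> * real ?d ^ k / (a ^ e * \<beta> ^ k) * ?s ^ k * (f r * (min (\<tau> * r) \<sigma> / (\<tau> * r)) ^ e)"
      proof -
        have Rd: "R ^ ?d = R ^ k * (f r / a ^ e)" by (simp add: e(2)[symmetric] power_add Re)
        show ?thesis
          unfolding w_def mA_def Rd using R t a \<beta> \<tau> r
          by (simp add: power_mult_distrib power_divide)
      qed
      also have "\<dots> \<le> \<omega> * real ?d ^ k / (a ^ e * \<beta> ^ k) * ?s ^ k * ((1 + (1 / (\<beta> * \<tau>)) ^ e) * f ?s)"
        using plate_gauge_bound[OF f r(1) _ \<sigma>(1) _ \<tau>(1) \<beta>] r \<sigma> s0 \<omega> a \<beta>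
        by (intro mult_left_mono) auto
      also have "\<dots> = C1 * ?s ^ k * f ?s" by (simp add: C1_def mult_ac)
      also have "\<dots> \<le> (C1 + C2) * ?s ^ k * f ?s" using Y2 by (simp add: distrib_right)
      finally show "ennreal w * emeasure lborel (A \<inter> cball x \<sigma>) \<le> ennreal ((C1 + C2) * ?s ^ k * f ?s)"
        by (simp add: ennreal_leI)
      have "\<omega> * \<sigma> ^ ?d = C2 * ?s ^ k * (\<eta> * ?s ^ e)"
      proof -
        have "C2 * ?s ^ k * (\<eta> * ?s ^ e) = C2 * \<eta> * (?s ^ k * ?s ^ e)" by (simp only: mult_ac)
        also have "?s ^ k * ?s ^ e = \<beta> ^ ?d * \<sigma> ^ ?d" unfolding power_add[symmetric] e(2) by (rule power_mult_distrib)
        also have "C2 * \<eta> * (\<beta> ^ ?d * \<sigma> ^ ?d) = \<omega> * \<sigma> ^ ?d" using \<beta> \<eta> by (simp add: C2_def)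
        finally show ?thesis by (rule sym)
      qed
      also have "\<dots> \<le> C2 * ?s ^ k * f ?s" using f_ge[OF s \<sigma>(2)] C2 s by (intro mult_left_mono) auto
      also have "\<dots> \<le> (C1 + C2) * ?s ^ k * f ?s" using Y1 by (simp add: distrib_right)
      finally show "emeasure lborel (cball (0 :: real ^ 'n) \<sigma>) \<le> ennreal ((C1 + C2) * ?s ^ k * f ?s)"
        using \<omega>(2)[of \<sigma> 0] \<sigma> by (simp add: ennreal_leI)
    qed
    show ?thesis
      unfolding R_def[symmetric]
      by (rule exI[of _ A], rule exI[of _ "ennreal w"], intro conjI allI impI A(1,2) near mass bound) (elim conjE, assumption)+
  qed
  show thesis
  proof (rule that[OF a(1) _ _ s0])
    show "\<forall>x. a * norm x \<le> N x" using a(2) by blast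
    show "0 < C1 + C2" using C1 C2 by simp
  qed (intro allI impI, elim conjE, rule main)
qed

section \<open>Tubes have full content\<close>

lemma weight_emeasure_UN:
  assumes "countable I" "\<And>i. i \<in> I \<Longrightarrow> X i \<in> sets M" "disjoint_family_on X I"
  shows "weight (\<lambda>i. emeasure M (X i)) I = emeasure M (\<Union>i\<in>I. X i)"
  unfolding weight_eq by (rule emeasure_UN_countable[symmetric]) (use assms in auto)

lemma diamN_mono: "A \<subseteq> B \<Longrightarrow> diamN N A \<le> diamN N B"
  unfolding diamN_def by (intro SUP_subset_mono) auto

context net_gauge
begin

text \<open>The mass distribution is never formed as a measure: its value on a cube is a sum over
  plates. Exchanging the sums over plates and cubes turns the bound \<open>cube\<close> into a lower
  bound for the cost of the whole cover.\<close>

lemma full_content_tubes: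
  fixes P :: "'i \<Rightarrow> (real ^ 'n) set" and r :: "'i \<Rightarrow> real"
  assumes k: "k < CARD('n)" and e: "e = CARD('n) - k" and f: "f \<in> gauges e"
    and P: "\<And>i. i \<in> J \<Longrightarrow> affine (P i)" "\<And>i. i \<in> J \<Longrightarrow> aff_dim (P i) = int k" "\<And>i. i \<in> J \<Longrightarrow> 0 < r i"
    and dom: "\<And>M. 0 < M \<Longrightarrow> \<exists>s>0. \<forall>t. 0 < t \<and> t \<le> s \<longrightarrow> M * (t ^ k * f t) \<le> g t"
    and cov: "AE x in lebesgue. x \<in> V \<longrightarrow>
       (\<forall>\<delta>>0. \<exists>i\<in>J. r i < \<delta> \<and> distN N x (P i) < f (r i) powr (1 / real e))"
  shows "full_content (\<Union>i\<in>J. {x. distN N x (P i) < r i}) V"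
proof (rule full_contentI)
  fix K :: real assume K: "0 < K"
  let ?d = "CARD('n)"
  let ?W = "\<Union>i\<in>J. {x. distN N x (P i) < r i}"
  \<comment> \<open>Ratio between the \<open>N\<close>-diameter of a cube and the radius \<sigma> of
    a Euclidean ball containing it, namely CARD('n) times its side. Thus \<beta> \<sigma> is the
    diameter entering the gauge.\<close>
  define \<beta> where "\<beta> = diam_unit / ?d"
  have \<beta>: "0 < \<beta>" using diam_unit_pos by (simp add: \<beta>_def)
  have e0: "0 < e" using k e by simp
  obtain a C s0 where a: "0 < a" "\<forall>x. a * norm x \<le> N x" and C: "0 < C" and s0: "0 < s0" "s0 < gauge_eps e f"
    and plates: "\<forall>P y r. affine P \<and> aff_dim P = int k \<and> y \<in> P \<and> 0 < r \<and> r \<le> s0 \<longrightarrow>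
      (\<exists>A w. A \<in> sets borel \<and> A \<subseteq> cball y (f r powr (1 / real e) / a) \<and> A \<subseteq> {x. distN N x P < r} \<and>
        w * emeasure lborel A = emeasure lborel (cball y (f r powr (1 / real e) / a)) \<and>
        (\<forall>Q x \<sigma>. Q \<in> sets borel \<and> Q \<subseteq> cball x \<sigma> \<and> 0 < \<sigma> \<and> \<beta> * \<sigma> \<le> s0 \<longrightarrow>
          w * emeasure lborel (A \<inter> Q) * emeasure lborel (cball (0 :: real ^ 'n) \<sigma>) \<le>
            ennreal (C * (\<beta> * \<sigma>) ^ k * f (\<beta> * \<sigma>)) *
            emeasure lborel (cball y (f r powr (1 / real e) / a) \<inter> cball x (3 * \<sigma>))))"
    by (rule tube_plates[OF norm k e f \<beta>])
  obtain \<omega> where \<omega>: "0 < \<omega>" "\<And>(y :: real ^ 'n) r. 0 \<le> r \<Longrightarrow> emeasure lborel (cball y r) = ennreal (\<omega> * r ^ ?d)"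
    using emeasure_cball_power by metis
  \<comment> \<open>\<open>C\<close> comes from the plates, 3^d from the enlarged ball around a
    cube, and \<open>K\<close> is the multiple of the volume to be gained.\<close>
  obtain s2 where s2: "0 < s2" "\<And>t. 0 < t \<Longrightarrow> t \<le> s2 \<Longrightarrow> (K * 3 ^ ?d * C) * (t ^ k * f t) \<le> g t"
    using dom[of "K * 3 ^ ?d * C"] K C by auto
  define s1 where "s1 = min s2 s0"
  have s1: "0 < s1" "s1 \<le> s2" "s1 \<le> s0" using s0 s2 by (auto simp: s1_def)
  obtain m where m: "\<And>j. m \<le> j \<Longrightarrow> real c powi (- j) < s1 / diam_unit"
    using adic_side_small[OF c2, of "s1 / diam_unit"] s1 diam_unit_pos by auto
  obtain Z where Z: "Z \<in> null_sets lebesgue"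
    "{x \<in> space lebesgue. \<not> (x \<in> V \<longrightarrow>
       (\<forall>\<delta>>0. \<exists>i\<in>J. r i < \<delta> \<and> distN N x (P i) < f (r i) powr (1 / real e)))} \<subseteq> Z"
    using cov unfolding eventually_ae_filter by blast
  have close: "\<exists>i\<in>J. r i < \<delta> \<and> distN N x (P i) < f (r i) powr (1 / real e)"
    if "x \<notin> Z" "x \<in> V" "0 < \<delta>" for x \<delta>
    using Z(2) that by auto
  \<comment> \<open>Dividing by \<open>a\<close> passes from \<open>N\<close> to the Euclidean norm:
    a point counted in \<open>cov\<close> lies in the Euclidean ball of radius \<open>R i\<close>
    about some point of \<open>P i\<close>.\<close>
  define R where "R i = f (r i) powr (1 / real e) / a" for i
  have f_pos: "0 < f t" if "0 < t" "t \<le> s0" for t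
    using gauge_pos[OF f _ that(1)] that s0 by simp
  have R_pos: "0 < R i" if "i \<in> J" "r i \<le> s1" for i
    using f_pos[of "r i"] P(3)[OF that(1)] that(2) s1 a by (simp add: R_def)
  show "\<exists>m. \<forall>j\<ge>m. \<forall>x. adic_cube c j x \<subseteq> V \<longrightarrow>
     (\<forall>\<C>\<subseteq>small_cubes. (\<forall>C\<in>\<C>. C \<subseteq> adic_cube c j x) \<longrightarrow> ?W \<inter> interior (adic_cube c j x) \<subseteq> \<Union>\<C> \<longrightarrow>
        ennreal K * emeasure lborel (adic_cube c j x) \<le> weight price \<C>)"
  proof (intro exI[of _ m] allI impI)
    fix j and x :: "real ^ 'n" and \<C>
    let ?Q0 = "adic_cube c j x"
    assume j: "m \<le> j" and V: "?Q0 \<subseteq> V" and small: "\<C> \<subseteq> small_cubes"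
      and sub: "\<forall>C\<in>\<C>. C \<subseteq> ?Q0" and covers: "?W \<inter> interior ?Q0 \<subseteq> \<Union>\<C>"
    define I where "I = {(i, y). i \<in> J \<and> y \<in> P i \<and> r i \<le> s1 \<and> cball y (R i) \<subseteq> interior ?Q0}"
    let ?B = "\<lambda>p. cball (snd p) (R (fst p))"
    have IJ: "fst p \<in> J" "snd p \<in> P (fst p)" "r (fst p) \<le> s1" "?B p \<subseteq> interior ?Q0" if "p \<in> I" for p
      using that by (auto simp: I_def)
    have vit: "\<exists>p. p \<in> I \<and> z \<in> ?B p \<and> R (fst p) < \<epsilon>" if z: "z \<in> interior ?Q0 - Z" and \<epsilon>: "0 < \<epsilon>" for z \<epsilon>
    proof -
      obtain \<epsilon>1 where \<epsilon>1: "0 < \<epsilon>1" "ball z \<epsilon>1 \<subseteq> interior ?Q0"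
        using z open_contains_ball[of "interior ?Q0"] by auto
      \<comment> \<open>A ball of radius below half of \<epsilon>1 that contains \<open>z\<close>
        stays in \<open>ball z \<epsilon>1\<close>, wherever its centre is.\<close>
      define \<epsilon>2 where "\<epsilon>2 = min \<epsilon> (\<epsilon>1 / 2)"
      have \<epsilon>2: "0 < \<epsilon>2" "\<epsilon>2 \<le> \<epsilon>" "2 * \<epsilon>2 \<le> \<epsilon>1" using \<epsilon> \<epsilon>1 by (auto simp: \<epsilon>2_def)
      have "0 < (a * \<epsilon>2) ^ e" using a \<epsilon>2 by simp
      then obtain \<delta> where \<delta>: "0 < \<delta>" "\<And>t. 0 \<le> t \<Longrightarrow> t < \<delta> \<Longrightarrow> f t < (a * \<epsilon>2) ^ e"
        using gauge_small[OF f] by metis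
      have "z \<in> V" using z V interior_subset by blast
      then obtain i where i: "i \<in> J" "r i < min \<delta> s1" "distN N z (P i) < f (r i) powr (1 / real e)"
        using close[of z "min \<delta> s1"] z \<delta>(1) s1(1) by auto
      have "P i \<noteq> {}" using P(2)[OF i(1)] by auto
      then obtain y where y: "y \<in> P i" "N (z - y) < f (r i) powr (1 / real e)"
        using distN_less_iff[OF norm] i(3) by metis
      have fr: "0 < f (r i)" using f_pos[of "r i"] P(3)[OF i(1)] i(2) s1 by simp
      have "a * norm (z - y) < f (r i) powr (1 / real e)" using a(2) y(2) by (meson le_less_trans)
      then have zy: "norm (z - y) < R i" using a(1) by (simp add: R_def pos_less_divide_eq mult.commute)
      have "f (r i) < (a * \<epsilon>2) ^ e" using \<delta>(2)[of "r i"] P(3)[OF i(1)] i(2) by simp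
      then have "f (r i) powr (1 / real e) < ((a * \<epsilon>2) ^ e) powr (1 / real e)"
        using fr e0 by (intro powr_less_mono2) auto
      also have "\<dots> = a * \<epsilon>2"
        using a(1) \<epsilon>2(1) e0 by (simp add: powr_realpow[symmetric] powr_powr)
      finally have R_less: "R i < \<epsilon>2" using a(1) by (simp add: R_def pos_divide_less_eq mult.commute)
      have "cball y (R i) \<subseteq> ball z \<epsilon>1"
      proof
        fix u assume "u \<in> cball y (R i)"
        then have "dist z u < R i + R i"
          using zy dist_triangle[of z u y] by (simp add: dist_norm)
        then show "u \<in> ball z \<epsilon>1" using R_less \<epsilon>2(3) by simp
      qed
      then have "(i, y) \<in> I" using i y \<epsilon>1(2) by (auto simp: I_def)
      moreover have "z \<in> ?B (i, y)" using zy by (simp add: dist_norm norm_minus_commute)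
      moreover have "R (fst (i, y)) < \<epsilon>" using R_less \<epsilon>2(2) by simp
      ultimately show ?thesis by blast
    qed
    obtain D where D: "countable D" "D \<subseteq> I" "pairwise (\<lambda>p q. disjnt (?B p) (?B q)) D"
      "negligible (interior ?Q0 - Z - (\<Union>p\<in>D. ?B p))"
      by (rule Vitali_covering_theorem_cballs[of I "\<lambda>p. R (fst p)" "interior ?Q0 - Z" snd])
        (use vit R_pos IJ in auto)
    have "\<forall>p\<in>I. \<exists>Aw. fst Aw \<in> sets borel \<and> fst Aw \<subseteq> ?B p \<and> fst Aw \<subseteq> {x. distN N x (P (fst p)) < r (fst p)} \<and>
        snd Aw * emeasure lborel (fst Aw) = emeasure lborel (?B p) \<and>
        (\<forall>Q x \<sigma>. Q \<in> sets borel \<and> Q \<subseteq> cball x \<sigma> \<and> 0 < \<sigma> \<and> \<beta> * \<sigma> \<le> s0 \<longrightarrow>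
          snd Aw * emeasure lborel (fst Aw \<inter> Q) * emeasure lborel (cball (0 :: real ^ 'n) \<sigma>) \<le>
            ennreal (C * (\<beta> * \<sigma>) ^ k * f (\<beta> * \<sigma>)) * emeasure lborel (?B p \<inter> cball x (3 * \<sigma>)))"
    proof
      fix p assume p: "p \<in> I"
      have "affine (P (fst p)) \<and> aff_dim (P (fst p)) = int k \<and> snd p \<in> P (fst p) \<and> 0 < r (fst p) \<and> r (fst p) \<le> s0"
        using IJ[OF p] P s1 by auto
      from plates[rule_format, OF this] obtain A w where Aw: "A \<in> sets borel \<and> A \<subseteq> ?B p \<and> A \<subseteq> {x. distN N x (P (fst p)) < r (fst p)} \<and>
        w * emeasure lborel A = emeasure lborel (?B p) \<and>
        (\<forall>Q x \<sigma>. Q \<in> sets borel \<and> Q \<subseteq> cball x \<sigma> \<and> 0 < \<sigma> \<and> \<beta> * \<sigma> \<le> s0 \<longrightarrow>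
          w * emeasure lborel (A \<inter> Q) * emeasure lborel (cball (0 :: real ^ 'n) \<sigma>) \<le>
            ennreal (C * (\<beta> * \<sigma>) ^ k * f (\<beta> * \<sigma>)) * emeasure lborel (?B p \<inter> cball x (3 * \<sigma>)))"
        unfolding R_def by (elim exE)
      show "\<exists>Aw. fst Aw \<in> sets borel \<and> fst Aw \<subseteq> ?B p \<and> fst Aw \<subseteq> {x. distN N x (P (fst p)) < r (fst p)} \<and>
        snd Aw * emeasure lborel (fst Aw) = emeasure lborel (?B p) \<and>
        (\<forall>Q x \<sigma>. Q \<in> sets borel \<and> Q \<subseteq> cball x \<sigma> \<and> 0 < \<sigma> \<and> \<beta> * \<sigma> \<le> s0 \<longrightarrow>
          snd Aw * emeasure lborel (fst Aw \<inter> Q) * emeasure lborel (cball (0 :: real ^ 'n) \<sigma>) \<le>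
            ennreal (C * (\<beta> * \<sigma>) ^ k * f (\<beta> * \<sigma>)) * emeasure lborel (?B p \<inter> cball x (3 * \<sigma>)))"
        by (rule exI[of _ "(A, w)"]) (simp only: fst_conv snd_conv, rule Aw)
    qed
    from bchoice[OF this] obtain Aw where Aw: "\<forall>p\<in>I. fst (Aw p) \<in> sets borel \<and> fst (Aw p) \<subseteq> ?B p \<and>
        fst (Aw p) \<subseteq> {x. distN N x (P (fst p)) < r (fst p)} \<and>
        snd (Aw p) * emeasure lborel (fst (Aw p)) = emeasure lborel (?B p) \<and>
        (\<forall>Q x \<sigma>. Q \<in> sets borel \<and> Q \<subseteq> cball x \<sigma> \<and> 0 < \<sigma> \<and> \<beta> * \<sigma> \<le> s0 \<longrightarrow>
          snd (Aw p) * emeasure lborel (fst (Aw p) \<inter> Q) * emeasure lborel (cball (0 :: real ^ 'n) \<sigma>) \<le>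
            ennreal (C * (\<beta> * \<sigma>) ^ k * f (\<beta> * \<sigma>)) * emeasure lborel (?B p \<inter> cball x (3 * \<sigma>)))" ..
    define A where "A p = fst (Aw p)" for p
    define w where "w p = snd (Aw p)" for p
    have A: "A p \<in> sets borel" "A p \<subseteq> ?B p" "A p \<subseteq> {x. distN N x (P (fst p)) < r (fst p)}"
        "w p * emeasure lborel (A p) = emeasure lborel (?B p)" if "p \<in> D" for p
      using Aw D(2) that unfolding A_def w_def by blast+
    have bound: "w p * emeasure lborel (A p \<inter> Q) * emeasure lborel (cball (0 :: real ^ 'n) \<sigma>) \<le>
            ennreal (C * (\<beta> * \<sigma>) ^ k * f (\<beta> * \<sigma>)) * emeasure lborel (?B p \<inter> cball x (3 * \<sigma>))"
      if "p \<in> D" "Q \<in> sets borel" "Q \<subseteq> cball x \<sigma>" "0 < \<sigma>" "\<beta> * \<sigma> \<le> s0" for p Q x \<sigma>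
      using Aw D(2) that unfolding A_def w_def by blast
    have cube: "ennreal K * weight (\<lambda>p. w p * emeasure lborel (A p \<inter> Q)) D \<le> price Q" if Q: "Q \<in> \<C>" for Q
    proof -
      obtain l u where Q_eq: "Q = adic_cube c l u" using small Q small_cubeE by (metis subsetD)
      define s where "s = real c powi (- l) * diam_unit"
      define \<sigma> where "\<sigma> = real ?d * real c powi (- l)"
      have \<sigma>: "0 < \<sigma>" using side_pos by (simp add: \<sigma>_def)
      have \<beta>\<sigma>: "\<beta> * \<sigma> = s" by (simp add: \<beta>_def \<sigma>_def s_def)
      have s_pos: "0 < s" using diam_unit_pos side_pos by (simp add: s_def)
      have "diamN N Q \<le> diamN N ?Q0" using Q sub by (intro diamN_mono) auto
      then have "s \<le> real c powi (- j) * diam_unit"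
        using diam_unit_pos side_pos[of "- j"] by (simp add: Q_eq diam_cube ennreal_le_iff flip: s_def)
      also have "\<dots> \<le> s1" using m[OF j] diam_unit_pos by (simp add: pos_less_divide_eq)
      finally have s_le: "s \<le> s1" .
      have Q_sub: "Q \<subseteq> cball u \<sigma>"
        using adic_cube_norm_diff[OF c0 adic_cube_self[of u c l]]
        by (auto simp: Q_eq \<sigma>_def dist_norm)
      have Q_borel: "Q \<in> sets borel" by (simp add: Q_eq adic_cube_borel)
      define Y where "Y = C * s ^ k * f s"
      have Y: "0 \<le> Y" using C s_pos f_pos[of s] s_le s1 by (simp add: Y_def)
      let ?v = "emeasure lborel (cball (0 :: real ^ 'n) \<sigma>)"
      have v: "?v = ennreal (\<omega> * \<sigma> ^ ?d)" using \<omega>(2) \<sigma> by simp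
      \<comment> \<open>Each plate meeting \<open>Q\<close> is charged to the part of its own Vitali
        ball near \<open>Q\<close>. As the balls are disjoint, these parts have total volume at most
        that of the enlarged ball.\<close>
      have disj: "disjoint_family_on (\<lambda>p. ?B p \<inter> cball u (3 * \<sigma>)) D"
        using D(3) unfolding disjoint_family_on_def pairwise_def disjnt_def by blast
      have "?v * weight (\<lambda>p. w p * emeasure lborel (A p \<inter> Q)) D =
          weight (\<lambda>p. ?v * (w p * emeasure lborel (A p \<inter> Q))) D" by (rule weight_cmult[symmetric])
      also have "\<dots> \<le> weight (\<lambda>p. ennreal Y * emeasure lborel (?B p \<inter> cball u (3 * \<sigma>))) D"
      proof (rule weight_fun_mono)
        fix p assume "p \<in> D"
        then show "?v * (w p * emeasure lborel (A p \<inter> Q)) \<le> ennreal Y * emeasure lborel (?B p \<inter> cball u (3 * \<sigma>))"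
          using bound[OF _ Q_borel Q_sub \<sigma>, of p] s_le s1(3) unfolding \<beta>\<sigma> Y_def by (simp only: mult.commute)
      qed
      also have "\<dots> = ennreal Y * emeasure lborel (\<Union>p\<in>D. ?B p \<inter> cball u (3 * \<sigma>))"
        unfolding weight_cmult using disj D(1) by (subst weight_emeasure_UN) auto
      also have "\<dots> \<le> ennreal Y * emeasure lborel (cball u (3 * \<sigma>))"
        by (intro mult_left_mono emeasure_mono) auto
      also have "emeasure lborel (cball u (3 * \<sigma>)) = ?v * ennreal (3 ^ ?d)"
        using \<omega> \<sigma> by (simp add: v ennreal_mult[symmetric] power_mult_distrib mult_ac)
      also have "ennreal Y * (?v * ennreal (3 ^ ?d)) = ?v * ennreal (3 ^ ?d * Y)"
        using Y by (simp add: ennreal_mult mult_ac)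
      finally have "weight (\<lambda>p. w p * emeasure lborel (A p \<inter> Q)) D \<le> ennreal (3 ^ ?d * Y)"
        using \<omega>(1) \<sigma> unfolding v by (subst (asm) ennreal_mult_le_mult_iff) auto
      then have "ennreal K * weight (\<lambda>p. w p * emeasure lborel (A p \<inter> Q)) D \<le> ennreal K * ennreal (3 ^ ?d * Y)"
        by (rule mult_left_mono) simp
      also have "\<dots> = ennreal ((K * 3 ^ ?d * C) * (s ^ k * f s))"
      proof -
        have "ennreal K * ennreal (3 ^ ?d * Y) = ennreal (K * (3 ^ ?d * Y))"
          using K Y by (intro ennreal_mult[symmetric]) auto
        then show ?thesis by (simp only: Y_def mult_ac)
      qed
      also have "\<dots> \<le> ennreal (g s)" using s2(2)[OF s_pos] s_le s1 by (intro ennreal_leI) simp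
      also have "\<dots> = price Q" by (simp add: Q_eq price_cube s_def)
      finally show ?thesis .
    qed
    have cover_A: "emeasure lborel (A p) \<le> weight (\<lambda>Q. emeasure lborel (A p \<inter> Q)) \<C>" if p: "p \<in> D" for p
    proof -
      have \<C>_borel: "Q \<in> sets borel" if "Q \<in> \<C>" for Q
        using small that small_cubes_adic adic_cubes_borel[OF c0] by blast
      have "A p \<subseteq> \<Union>\<C>"
        using A(2,3)[OF p] IJ(1,4)[of p] p D(2) covers by blast
      \<comment> \<open>This density is the volume restricted to the plate, to which countable
        subadditivity applies.\<close>
      then have "emeasure (density lborel (indicator (A p))) (A p) \<le> weight (emeasure (density lborel (indicator (A p)))) \<C>"
        using \<C>_borel by (intro emeasure_le_weight countable_small[OF small]) auto
      also have "\<dots> \<le> weight (\<lambda>Q. emeasure lborel (A p \<inter> Q)) \<C>"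
        using \<C>_borel A(1)[OF p] by (intro weight_fun_mono) (simp add: emeasure_restricted)
      finally show ?thesis using A(1)[OF p] by (simp add: emeasure_restricted)
    qed
    have UB: "(\<Union>p\<in>D. ?B p) \<in> sets borel"
      using D(1) by (intro sets.countable_UN') auto
    \<comment> \<open>The boundary of the cube carries no volume, and the completed measure is used
      because \<open>Z\<close> is null only for it. What the Vitali balls miss is
      negligible.\<close>
    have "emeasure lborel ?Q0 = emeasure lebesgue (interior ?Q0)"
      by (simp add: emeasure_adic_cube[OF c0] emeasure_interior_adic_cube[OF c0])
    also have "\<dots> \<le> emeasure lebesgue ((\<Union>p\<in>D. ?B p) \<union> (Z \<union> (interior ?Q0 - Z - (\<Union>p\<in>D. ?B p))))"
      using D(1,4) Z(1) by (intro emeasure_mono) (auto intro!: sets.countable_UN' simp: negligible_iff_null_sets null_sets_def)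
    also have "\<dots> = emeasure lebesgue (\<Union>p\<in>D. ?B p)"
      using D(1,4) Z(1)
      by (intro emeasure_Un_null_set null_sets.Un) (auto intro!: sets.countable_UN' simp: negligible_iff_null_sets)
    also have "\<dots> = emeasure lborel (\<Union>p\<in>D. ?B p)"
      using UB by simp
    also have "\<dots> = weight (\<lambda>p. emeasure lborel (?B p)) D"
      using D(1,3) by (intro weight_emeasure_UN[symmetric])
        (auto simp: disjoint_family_on_def pairwise_def disjnt_def)
    also have "\<dots> \<le> weight (\<lambda>p. weight (\<lambda>Q. w p * emeasure lborel (A p \<inter> Q)) \<C>) D"
      unfolding weight_cmult
      by (intro weight_fun_mono) (use cover_A in \<open>auto simp flip: A(4) intro!: mult_left_mono\<close>)
    also have "\<dots> = weight (\<lambda>Q. weight (\<lambda>p. w p * emeasure lborel (A p \<inter> Q)) D) \<C>"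
      by (rule weight_swap)
    finally have "ennreal K * emeasure lborel ?Q0 \<le>
        ennreal K * weight (\<lambda>Q. weight (\<lambda>p. w p * emeasure lborel (A p \<inter> Q)) D) \<C>"
      by (rule mult_left_mono) simp
    also have "\<dots> = weight (\<lambda>Q. ennreal K * weight (\<lambda>p. w p * emeasure lborel (A p \<inter> Q)) D) \<C>"
      by (rule weight_cmult[symmetric])
    also have "\<dots> \<le> weight price \<C>" by (rule weight_fun_mono) (rule cube)
    finally show "ennreal K * emeasure lborel ?Q0 \<le> weight price \<C>" .
  qed
qed

end

section \<open>The limsup set\<close>

lemma open_distN_less:
  fixes N :: "'a::euclidean_space \<Rightarrow> real"
  assumes "is_norm N" "P \<noteq> {}"
  shows "open {x. distN N x P < r}"
proof -
  have "{x. distN N x P < r} = (\<Union>p\<in>P. {x. N (x - p) < r})"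
    using distN_less_iff[OF assms] by auto
  moreover have "open {x. N (x - p) < r}" for p
    by (intro open_Collect_less continuous_intros continuous_on_compose2[OF is_norm_continuous[OF assms(1), of UNIV]]) auto
  ultimately show ?thesis by (simp add: open_UN)
qed

text \<open>Expresses infinitude through the tails of an enumeration, which presents the limsup set
  as a countable intersection of open sets.\<close>

lemma infinite_iff_to_nat_on_unbounded:
  assumes "countable I"
  shows "infinite {i \<in> I. Q i} \<longleftrightarrow> (\<forall>n. \<exists>i\<in>I. n \<le> to_nat_on I i \<and> Q i)"
proof -
  have "finite {i \<in> I. Q i} \<longleftrightarrow> finite (to_nat_on I ` {i \<in> I. Q i})"
    using inj_on_to_nat_on[OF assms] by (intro finite_image_iff[symmetric]) (auto intro: inj_on_subset)
  then have "infinite {i \<in> I. Q i} \<longleftrightarrow> (\<forall>n. \<exists>m\<ge>n. m \<in> to_nat_on I ` {i \<in> I. Q i})"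
    by (simp add: infinite_nat_iff_unbounded_le)
  then show ?thesis by blast
qed

text \<open>Gauge values at radii that are not small may be negative; there \<open>powr\<close>
  takes its value at the absolute value, so a bound on the latter is the right hypothesis.\<close>

lemma powr_le_of_abs_le:
  fixes x :: real
  assumes "\<bar>x\<bar> \<le> B" "0 \<le> a"
  shows "x powr a \<le> B powr a"
proof -
  have "x powr a = \<bar>x\<bar> powr a" by (cases "0 \<le> x") (simp_all add: powr_def ln_minus)
  also have "\<dots> \<le> B powr a" using assms by (intro powr_mono2) auto
  finally show ?thesis .
qed

text \<open>The bound \<open>B\<close> forces every counted \<open>P i\<close> to meet one fixed
  ball about the origin, where the system is locally finite. Hence a point hit infinitely often is
  hit at arbitrarily small radii.\<close>

lemma finite_large_radius:
  fixes N :: "real ^ 'n \<Rightarrow> real"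
  assumes N: "is_norm N" and sys: "(P, r) \<in> approx_systems N k I"
    and \<delta>: "0 < \<delta>" and \<rho>: "\<And>i. i \<in> I \<Longrightarrow> \<rho> i \<le> B"
  shows "finite {i \<in> I. distN N x (P i) < \<rho> i \<and> \<delta> \<le> r i}"
proof -
  obtain m :: nat where m: "max (N x + B) (1 / \<delta>) < real m" using reals_Archimedean2 by blast
  have hom: "N (a *\<^sub>R x) = \<bar>a\<bar> * N x" and tri: "N (x + y) \<le> N x + N y" for a x y
    using N by (auto simp: is_norm_def)
  have fin: "finite {i \<in> I. P i \<inter> {x. N x < real m} \<noteq> {} \<and> 1 / real m < r i}"
    and dim: "\<And>i. i \<in> I \<Longrightarrow> aff_dim (P i) = int k"
    using sys unfolding approx_systems_def by auto
  have "1 / \<delta> < real m" using m by simp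
  moreover from this have "0 < real m" using \<delta> by (meson less_trans zero_less_divide_1_iff)
  ultimately have m\<delta>: "1 / real m < \<delta>" using \<delta> by (simp add: field_simps)
  have "{i \<in> I. distN N x (P i) < \<rho> i \<and> \<delta> \<le> r i} \<subseteq> {i \<in> I. P i \<inter> {x. N x < real m} \<noteq> {} \<and> 1 / real m < r i}"
  proof
    fix i assume "i \<in> {i \<in> I. distN N x (P i) < \<rho> i \<and> \<delta> \<le> r i}"
    then have i: "i \<in> I" "distN N x (P i) < \<rho> i" "\<delta> \<le> r i" by auto
    have "P i \<noteq> {}" using dim[OF i(1)] by auto
    then obtain p where p: "p \<in> P i" "N (x - p) < \<rho> i"
      using distN_less_iff[OF N] i(2) by metis
    have "N (p - x) = N (x - p)" using hom[of "-1" "x - p"] by simp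
    then have "N p < N x + B" using tri[of x "p - x"] p(2) \<rho>[OF i(1)] by simp
    then have "N p < real m" using m by simp
    then show "i \<in> {i \<in> I. P i \<inter> {x. N x < real m} \<noteq> {} \<and> 1 / real m < r i}"
      using p(1) i m\<delta> by auto
  qed
  then show ?thesis using fin by (rule finite_subset)
qed

text \<open>\<open>h\<close> mediates: near zero g(t) is at least \<open>M\<close> times t^k h(t),
  and \<open>h\<close> is at least \<open>f\<close>. Positivity of \<open>h\<close> and
  \<open>f\<close> clears the denominators.\<close>

lemma gauge_prec_dominates:
  assumes g: "gauge_prec g (\<lambda>s. s ^ k * h s)" and h: "gauge_prec h f"
    and hg: "h \<in> gauges e" and fg: "f \<in> gauges e" and M: "0 < M"
  shows "\<exists>s>0. \<forall>t. 0 < t \<and> t \<le> s \<longrightarrow> M * (t ^ k * f t) \<le> g t"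
proof -
  have pos: "\<exists>\<epsilon>>0. \<forall>t. 0 < t \<and> t < \<epsilon> \<longrightarrow> 0 < u t" if "u \<in> gauges e" for u
    using gauge_eps_pos[OF that] gauge_pos[OF that] by blast
  obtain \<epsilon>1 where \<epsilon>1: "0 < \<epsilon>1" "\<And>t. 0 < t \<Longrightarrow> t < \<epsilon>1 \<Longrightarrow> 0 < h t" using pos[OF hg] by blast
  obtain \<epsilon>2 where \<epsilon>2: "0 < \<epsilon>2" "\<And>t. 0 < t \<Longrightarrow> t < \<epsilon>2 \<Longrightarrow> 0 < f t" using pos[OF fg] by blast
  have "eventually (\<lambda>t. M \<le> g t / (t ^ k * h t)) (at_right 0)"
    using g unfolding gauge_prec_def filterlim_at_top by blast
  then obtain \<epsilon>3 where \<epsilon>3: "0 < \<epsilon>3" "\<And>t. 0 < t \<Longrightarrow> t < \<epsilon>3 \<Longrightarrow> M \<le> g t / (t ^ k * h t)"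
    unfolding eventually_at_right_field by blast
  have "eventually (\<lambda>t. 1 \<le> h t / f t) (at_right 0)"
    using h unfolding gauge_prec_def filterlim_at_top by blast
  then obtain \<epsilon>4 where \<epsilon>4: "0 < \<epsilon>4" "\<And>t. 0 < t \<Longrightarrow> t < \<epsilon>4 \<Longrightarrow> 1 \<le> h t / f t"
    unfolding eventually_at_right_field by blast
  define s where "s = min (min \<epsilon>1 \<epsilon>2) (min \<epsilon>3 \<epsilon>4) / 2"
  have s: "0 < s" "s < \<epsilon>1" "s < \<epsilon>2" "s < \<epsilon>3" "s < \<epsilon>4"
    using \<epsilon>1(1) \<epsilon>2(1) \<epsilon>3(1) \<epsilon>4(1) by (auto simp: s_def)
  have "M * (t ^ k * f t) \<le> g t" if t: "0 < t" "t \<le> s" for t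
  proof -
    have h_pos: "0 < h t" and f_pos: "0 < f t" using \<epsilon>1(2) \<epsilon>2(2) t s by auto
    have "f t \<le> h t" using \<epsilon>4(2)[of t] t s f_pos by (simp add: pos_le_divide_eq)
    then have "M * (t ^ k * f t) \<le> M * (t ^ k * h t)" using M t by (intro mult_left_mono) auto
    also have "\<dots> \<le> g t" using \<epsilon>3(2)[of t] t s h_pos by (simp add: pos_le_divide_eq)
    finally show ?thesis .
  qed
  then show ?thesis using s(1) by blast
qed

theorem theorem4:
  fixes N :: "real ^ 'n \<Rightarrow> real"
    and c k :: nat
    and I :: "'i set"
    and P :: "'i \<Rightarrow> (real ^ 'n) set"
    and r :: "'i \<Rightarrow> real"
    and h :: "real \<Rightarrow> real"
    and V :: "(real ^ 'n) set"
  assumes "is_norm N" and "2 \<le> c"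
    and "k < CARD('n)"
    and "countable I" and "infinite I"
    and "(P, r) \<in> approx_systems N k I"
    and "h \<in> gauges (CARD('n) - k)"
    and "open V" and "V \<noteq> {}"
    and A: "\<exists>T. affine T \<and> aff_dim T = int (CARD('n) - k) \<and>
              (\<forall>i\<in>I. T \<inter> P i \<noteq> {}) \<and>
              (SUP i\<in>I. diamN N {x\<in>T. distN N x (P i) < 1}) < \<infinity>"
    and B: "\<exists>hl\<in>gauges (CARD('n) - k). gauge_prec h hl \<and>
              bounded ((\<lambda>i. hl (r i)) ` I) \<and>
              (AE x in lebesgue. x \<in> V \<longrightarrow>
                 infinite {i\<in>I. distN N x (P i) < hl (r i) powr (1 / real (CARD('n) - k))})"
  shows "limsup_set N I P r \<in> large_intersection_class N c (\<lambda>s. s ^ k * h s) V"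
proof -
  note N = \<open>is_norm N\<close> and I = \<open>countable I\<close> and sys = \<open>(P, r) \<in> approx_systems N k I\<close>
  define e where "e = CARD('n) - k"
  obtain f where f: "f \<in> gauges e" "gauge_prec h f" "bounded ((\<lambda>i. f (r i)) ` I)"
    and ae: "AE x in lebesgue. x \<in> V \<longrightarrow> infinite {i\<in>I. distN N x (P i) < f (r i) powr (1 / real e)}"
    using B unfolding e_def by blast
  have P: "affine (P i)" "aff_dim (P i) = int k" "0 < r i" if "i \<in> I" for i
    using sys that unfolding approx_systems_def by auto
  have ne: "P i \<noteq> {}" if "i \<in> I" for i using P(2)[OF that] by auto
  \<comment> \<open>The values \<open>f (r i)\<close> at radii outside the interval of the gauge are
    controlled by the boundedness in (B) alone.\<close>
  obtain b where b: "\<And>i. i \<in> I \<Longrightarrow> \<bar>f (r i)\<bar> \<le> b"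
    using f(3) unfolding bounded_iff by auto
  have bound: "f (r i) powr (1 / real e) \<le> b powr (1 / real e)" if "i \<in> I" for i
    using b[OF that] by (intro powr_le_of_abs_le) auto
  define J where "J n = {i \<in> I. n \<le> to_nat_on I i}" for n
  define W where "W n = (\<Union>i\<in>J n. {x. distN N x (P i) < r i})" for n
  have limsup: "limsup_set N I P r = (\<Inter>n. W n)"
    unfolding limsup_set_def infinite_iff_to_nat_on_unbounded[OF I] by (auto simp: W_def J_def)
  have W_open: "open (W n)" for n
    unfolding W_def J_def using open_distN_less[OF N] ne by (intro open_UN) auto
  \<comment> \<open>Among infinitely many hits only finitely many have radius at least \<delta>; the
    others still form an infinite set, so every tail \<open>J n\<close> contains one of
    them.\<close>
  have cov: "AE x in lebesgue. x \<in> V \<longrightarrow>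
       (\<forall>\<delta>>0. \<exists>i\<in>J n. r i < \<delta> \<and> distN N x (P i) < f (r i) powr (1 / real e))" for n
    using ae
  proof eventually_elim
    case (elim x)
    show ?case
    proof (intro impI allI)
      fix \<delta> :: real assume "x \<in> V" "0 < \<delta>"
      let ?S = "{i\<in>I. distN N x (P i) < f (r i) powr (1 / real e)}"
      let ?L = "{i\<in>I. distN N x (P i) < f (r i) powr (1 / real e) \<and> \<delta> \<le> r i}"
      have "finite ?L" by (rule finite_large_radius[OF N sys \<open>0 < \<delta>\<close> bound])
      then have "infinite (?S - ?L)" using elim \<open>x \<in> V\<close> by (simp add: Diff_infinite_finite)
      moreover have "?S - ?L = {i \<in> I. distN N x (P i) < f (r i) powr (1 / real e) \<and> r i < \<delta>}" by auto
      ultimately have "infinite {i \<in> I. distN N x (P i) < f (r i) powr (1 / real e) \<and> r i < \<delta>}" by simp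
      then show "\<exists>i\<in>J n. r i < \<delta> \<and> distN N x (P i) < f (r i) powr (1 / real e)"
        unfolding infinite_iff_to_nat_on_unbounded[OF I] J_def by blast
    qed
  qed
  have "gdelta_in euclidean (\<Inter>n. W n)"
    using W_open by (intro gdelta_in_Inter) (auto intro: open_imp_gdelta_in)
  moreover have "net_content N c g ((\<Inter>n. W n) \<inter> U) = net_content N c g U"
    if g: "g \<in> gauges CARD('n)" "gauge_prec g (\<lambda>s. s ^ k * h s)" and U: "open U" "U \<subseteq> V" for g U
  proof -
    interpret net_gauge N c g by unfold_locales fact+
    have "full_content (W n) V" for n
      unfolding W_def
    proof (rule full_content_tubes[OF \<open>k < CARD('n)\<close> e_def f(1)])
      show "\<exists>s>0. \<forall>t. 0 < t \<and> t \<le> s \<longrightarrow> M * (t ^ k * f t) \<le> g t" if "0 < M" for M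
        using gauge_prec_dominates[OF g(2) f(2) _ f(1) that] \<open>h \<in> _\<close> by (simp add: e_def)
    qed (use P cov J_def in auto)
    then show ?thesis by (rule net_content_Inter[OF W_open _ U])
  qed
  ultimately show ?thesis
    unfolding large_intersection_class_def limsup by blast
qed

end
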